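(* Let $D\subseteq\mathbb{R}^k$ be an open set with $0\in D$, let $\Omega\subseteq D$ with $0\in\Omega$, let $S=\{0\}$, let $h:D\to\mathbb{R}^m$ be continuous with $h(0)=0$, and let $f:D\times D\times D\to\mathbb{R}^k$ be locally Lipschitz. For $n\in\mathbb{N}$ let $(\Sigma_n)$ be the string $\dot x_i=f(x_{i-1},x_i,x_{i+1})$, $y_i=h(x_i)$, $i=1,\dots,n$, with $x_0=u\in\Omega$, $x_{n+1}=w\in S=\{0\}$. Suppose that $(\Sigma_n)$ is forward complete for every $n\in\mathbb{N}$. Let $p\in[1,+\infty)$ and suppose that there exist $V\in C^1(D;\mathbb{R}_+)$, $g,r\in C^0(D^2;\mathbb{R})$ and constants $\sigma,\omega,\Gamma_1\ge0$, $c>0$, $L\ge1$ such that $$\nabla V(x)f(u,x,w)\le -c|h(x)|^p+g(u,x)+r(x,w)\quad\text{for all }x,u,w\in D,$$ $$g(u,x)\le\Gamma_1|h(u)|^p+c\omega|h(x)|^p\quad\text{for all }x\in D,\ u\in\Omega,$$ $$r(x,w)+Lg(x,w)\le c\sigma|h(x)|^p+c\omega L|h(w)|^p\quad\text{for all }x,w\in D,$$ $$r(x,0)\le c\sigma|h(x)|^p\quad\text{for all }x\in D.$$ If $\sigma+\omega<1$, then the string $(\Sigma_n)_{n\in\mathbb{N}}$ with $S=\{0\}$ is $L^p$ string stable; moreover, the string stability estimate $$\|y_i\|_{[0,t],p}\le a_1\left(\|h(u)\|_{[0,t],p}\right)+a_2\left(\|h(w)\|_{[0,t],p}\right)+Q_n(\xi)$$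 (for all $n\in\mathbb{N}$, $\xi\in D^n$, $u\in\mho(\Omega)$, $w\in\mho(S)$, $t\ge0$, $i=1,\dots,n$, along the solution of $(\Sigma_n)$ with $x(0)=\xi$) holds with $$a_1(s)=\left(\frac{\Gamma_1}{c(1-\sigma-\omega)}\right)^{1/p}s\quad\text{for all }s\ge0,\qquad a_2(s)\equiv0,$$ $$Q_n(\xi_1,\dots,\xi_n)=\left(\frac{1}{c(1-\sigma-\omega)}\sum_{i=1}^nL^{i-1}V(\xi_i)\right)^{1/p}\quad\text{for all }(\xi_1,\dots,\xi_n)\in D^n.$$ Finally, if (i) for every $\rho>0$ the set $\{\xi\in D:V(\xi)\le\rho,\ |\xi|\le\rho\}$ is compact (in the standard topology of $\mathbb{R}^k$), and (ii) for every compact set $\bar\Omega\subseteq\Omega$ and every $\rho>0$, the sets $f(\Phi_\rho\times\Phi_\rho\times\Phi_\rho)$, $f(\bar\Omega\times\Phi_\rho\times\Phi_\rho)$, $f(\Phi_\rho\times\Phi_\rho\times\{0\})$ are bounded, where $\Phi_\rho=\{\xi\in D:V(\xi)\le\rho\}$, then the assumption that $(\Sigma_n)$ with $S=\{0\}$ is forward complete for every $n\in\mathbb{N}$ is not needed (that is, if $\sigma+\omega<1$, then without assuming forward completeness the string $(\Sigma_n)_{n\in\mathbb{N}}$ with $S=\{0\}$ is still $L^p$ string stable, and the estimate $\|y_i\|_{[0,t],p}\le a_1(\|h(u)\|_{[0,t],p})+a_2(\|h(w)\|_{[0,t],p})+Q_n(\xi)$ still holds with $a_1(s)=\left(\frac{\Gamma_1}{c(1-\sigma-\omega)}\right)^{1/p}s$,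 $a_2(s)\equiv0$ and $Q_n(\xi_1,\dots,\xi_n)=\left(\frac{1}{c(1-\sigma-\omega)}\sum_{i=1}^nL^{i-1}V(\xi_i)\right)^{1/p}$).
   Context: Notation. $\mathbb{R}_+=[0,+\infty)$, $|\cdot|$ is the Euclidean norm, and $\nabla V(x)=\left(\frac{\partial V}{\partial x_1}(x),\dots,\frac{\partial V}{\partial x_k}(x)\right)$ is a row vector. For a set $A\subseteq\mathbb{R}^q$, $\mho(A)$ is the set of Lebesgue measurable, locally essentially bounded functions $u:\mathbb{R}_+\to A$ such that for every $T>0$ there is a compact set $\Omega_T\subseteq A$ with $u(t)\in\Omega_T$ for almost every $t\in[0,T]$. For a locally essentially bounded measurable signal $y$ on $\mathbb{R}_+$, $t\ge0$ and $p\in[1,+\infty)$: $\|y\|_{[0,t],p}=\left(\int_0^t|y(s)|^p\,ds\right)^{1/p}$. Forward completeness. The state of $(\Sigma_n)$ is $x=(x_1,\dots,x_n)\in D^n$. The system $(\Sigma_n)$ is forward complete if for every $\xi\in D^n$, $u\in\mho(\Omega)$, $w\in\mho(S)$ the (unique, Carathéodory) solution $x(t)\in D^n$ with $x(0)=\xi$ exists for all $t\ge 0$. $L^p$ string stability. The string $(\Sigma_n)_{n\in\mathbb{N}}$ (with input sets $\Omega,S$) is $L^p$ string stable if there exist non-decreasing functions $a_1,a_2\in C^0(\mathbb{R}_+;\mathbb{R}_+)$, independent of $n$, such that for every $n\in\mathbb{N}$: (i) $(\Sigma_n)$ is forward complete, and (ii) there exists $Q_n\in C^0(D^n;\mathbb{R}_+)$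 such that for every $\xi\in D^n$, $u\in\mho(\Omega)$, $w\in\mho(S)$ the solution of $(\Sigma_n)$ with $x(0)=\xi$ satisfies, for all $t\ge0$ and $i=1,\dots,n$, $\|y_i\|_{[0,t],p}\le a_1(\|h(u)\|_{[0,t],p})+a_2(\|h(w)\|_{[0,t],p})+Q_n(\xi)$. (With $S=\{0\}$ this property is also called $L^p$ one-sided string stability.) *)

theory Defs
  imports "HOL-Analysis.Analysis"
begin

(* Signals are total functions on real; only their values on {0..} are ever used.
   The input class: values in A, measurable, locally essentially bounded, and on each [0,T]
   almost everywhere in some compact subset of A. *)
definition admissible_inputs :: "'a::euclidean_space set \<Rightarrow> (real \<Rightarrow> 'a) set" where
  "admissible_inputs A =
    {u. u \<in> borel_measurable (lebesgue_on {0..}) \<and>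
        (\<forall>t\<ge>0. u t \<in> A) \<and>
        (\<forall>T>0. \<exists>B. AE t in lebesgue_on {0..T}. norm (u t) \<le> B) \<and>
        (\<forall>T>0. \<exists>K. compact K \<and> K \<subseteq> A \<and> (AE t in lebesgue_on {0..T}. u t \<in> K))}"

definition Lp_norm :: "real \<Rightarrow> real \<Rightarrow> (real \<Rightarrow> 'a::euclidean_space) \<Rightarrow> real" where
  "Lp_norm p t y = (LINT s:{0..t}|lebesgue. norm (y s) powr p) powr (1 / p)"

definition locally_lipschitz_on :: "'a::metric_space set \<Rightarrow> ('a \<Rightarrow> 'b::metric_space) \<Rightarrow> bool" where
  "locally_lipschitz_on X f \<longleftrightarrow>
    (\<forall>x\<in>X. \<exists>e>0. \<exists>M. M-lipschitz_on (cball x e \<inter> X) f)"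

(* For differentiable V, the Frechet derivative in the direction of the i-th unit vector
   is the i-th partial derivative. *)
definition grad :: "(real ^ 'k \<Rightarrow> real) \<Rightarrow> real ^ 'k \<Rightarrow> real ^ 'k" where
  "grad V x = (\<chi> i. frechet_derivative V (at x) (axis i 1))"

(* Intended for open D. *)
definition C1_on :: "(real ^ 'k) set \<Rightarrow> (real ^ 'k \<Rightarrow> real) \<Rightarrow> bool" where
  "C1_on D V \<longleftrightarrow> (\<forall>x\<in>D. V differentiable (at x)) \<and> continuous_on D (grad V)"

(* Absolute continuity on [a,b]: the members of a division are finitely many
   non-overlapping compact intervals [Inf K, Sup K]. *)
definition abs_continuous_on_interval ::
    "real \<Rightarrow> real \<Rightarrow> (real \<Rightarrow> 'a::euclidean_space) \<Rightarrow> bool" where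
  "abs_continuous_on_interval a b x \<longleftrightarrow>
    (\<forall>\<epsilon>>0. \<exists>\<delta>>0. \<forall>d X. d division_of X \<and> X \<subseteq> {a..b} \<and> (\<Sum>K\<in>d. Sup K - Inf K) < \<delta> \<longrightarrow>
       (\<Sum>K\<in>d. norm (x (Sup K) - x (Inf K))) < \<epsilon>)"

(* D^n, as extensional functions on {1..n}.  The subspace topology inherited from the
   product topology on nat => real^'k is the usual topology of D^n. *)
definition states :: "(real ^ 'k) set \<Rightarrow> nat \<Rightarrow> (nat \<Rightarrow> real ^ 'k) set" where
  "states D n = {1..n} \<rightarrow>\<^sub>E D"

(* x_0 = u and x_(n+1) = w *)
definition with_boundary :: "nat \<Rightarrow> 'a \<Rightarrow> 'a \<Rightarrow> (nat \<Rightarrow> 'a) \<Rightarrow> nat \<Rightarrow> 'a" where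
  "with_boundary n u w x i = (if i = 0 then u else if i = n + 1 then w else x i)"

definition string_rhs ::
    "((real ^ 'k) \<times> (real ^ 'k) \<times> (real ^ 'k) \<Rightarrow> real ^ 'k) \<Rightarrow> nat \<Rightarrow> real ^ 'k \<Rightarrow> real ^ 'k
      \<Rightarrow> (nat \<Rightarrow> real ^ 'k) \<Rightarrow> nat \<Rightarrow> real ^ 'k" where
  "string_rhs f n u w x i =
    f (with_boundary n u w x (i - 1), with_boundary n u w x i, with_boundary n u w x (i + 1))"

(* Caratheodory solutions on [0,\<infinity>): locally absolutely continuous, satisfying the
   differential equation almost everywhere.  The two-sided derivative is harmless since
   t = 0 is a null set. *)
definition is_solution ::
    "(real ^ 'k) set \<Rightarrow> ((real ^ 'k) \<times> (real ^ 'k) \<times> (real ^ 'k) \<Rightarrow> real ^ 'k) \<Rightarrow> nat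
      \<Rightarrow> (nat \<Rightarrow> real ^ 'k) \<Rightarrow> (real \<Rightarrow> real ^ 'k) \<Rightarrow> (real \<Rightarrow> real ^ 'k)
      \<Rightarrow> (real \<Rightarrow> nat \<Rightarrow> real ^ 'k) \<Rightarrow> bool" where
  "is_solution D f n \<xi> u w x \<longleftrightarrow>
     x 0 = \<xi> \<and>
     (\<forall>t\<ge>0. x t \<in> states D n) \<and>
     (\<forall>i\<in>{1..n}. \<forall>T>0. abs_continuous_on_interval 0 T (\<lambda>t. x t i)) \<and>
     (\<forall>i\<in>{1..n}. AE t in lebesgue_on {0..}.
        ((\<lambda>s. x s i) has_vector_derivative string_rhs f n (u t) (w t) (x t) i) (at t))"

definition forward_complete ::
    "(real ^ 'k) set \<Rightarrow> (real ^ 'k) set \<Rightarrow> (real ^ 'k) set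
      \<Rightarrow> ((real ^ 'k) \<times> (real ^ 'k) \<times> (real ^ 'k) \<Rightarrow> real ^ 'k) \<Rightarrow> nat \<Rightarrow> bool" where
  "forward_complete D \<Omega> S f n \<longleftrightarrow>
     (\<forall>\<xi>\<in>states D n. \<forall>u\<in>admissible_inputs \<Omega>. \<forall>w\<in>admissible_inputs S.
        \<exists>x. is_solution D f n \<xi> u w x)"

definition string_estimate ::
    "(real ^ 'k) set \<Rightarrow> (real ^ 'k) set \<Rightarrow> (real ^ 'k) set
      \<Rightarrow> ((real ^ 'k) \<times> (real ^ 'k) \<times> (real ^ 'k) \<Rightarrow> real ^ 'k) \<Rightarrow> (real ^ 'k \<Rightarrow> real ^ 'm) \<Rightarrow> real
      \<Rightarrow> (real \<Rightarrow> real) \<Rightarrow> (real \<Rightarrow> real) \<Rightarrow> ((nat \<Rightarrow> real ^ 'k) \<Rightarrow> real) \<Rightarrow> nat \<Rightarrow> bool" where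
  "string_estimate D \<Omega> S f h p a1 a2 Q n \<longleftrightarrow>
     (\<forall>\<xi>\<in>states D n. \<forall>u\<in>admissible_inputs \<Omega>. \<forall>w\<in>admissible_inputs S.
        \<forall>x. is_solution D f n \<xi> u w x \<longrightarrow>
          (\<forall>t\<ge>0. \<forall>i\<in>{1..n}.
             Lp_norm p t (\<lambda>s. h (x s i))
               \<le> a1 (Lp_norm p t (\<lambda>s. h (u s))) + a2 (Lp_norm p t (\<lambda>s. h (w s))) + Q \<xi>))"

definition Lp_string_stable ::
    "(real ^ 'k) set \<Rightarrow> (real ^ 'k) set \<Rightarrow> (real ^ 'k) set
      \<Rightarrow> ((real ^ 'k) \<times> (real ^ 'k) \<times> (real ^ 'k) \<Rightarrow> real ^ 'k) \<Rightarrow> (real ^ 'k \<Rightarrow> real ^ 'm) \<Rightarrow> real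
      \<Rightarrow> bool" where
  "Lp_string_stable D \<Omega> S f h p \<longleftrightarrow>
     (\<exists>a1 a2 :: real \<Rightarrow> real.
        continuous_on {0..} a1 \<and> mono_on {0..} a1 \<and> (\<forall>s\<ge>0. 0 \<le> a1 s) \<and>
        continuous_on {0..} a2 \<and> mono_on {0..} a2 \<and> (\<forall>s\<ge>0. 0 \<le> a2 s) \<and>
        (\<forall>n\<ge>1. forward_complete D \<Omega> S f n \<and>
           (\<exists>Q. continuous_on (states D n) Q \<and> (\<forall>\<xi>\<in>states D n. 0 \<le> Q \<xi>) \<and>
                string_estimate D \<Omega> S f h p a1 a2 Q n)))"

end

theory Submission
  imports Defs "HOL-Probability.Discrete_Topology"
begin

text \<open>Along a solution the weighted storage \<open>W = (\<Sum>i=1..n. L ^ (i - 1) * V (x i))\<close> is absolutely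
  continuous, and the weights make the coupling terms of neighbours cancel, so that
  \<open>W' \<le> \<Gamma>1 * norm (h u) powr p - c * (1 - \<sigma> - \<omega>) * (\<Sum>i=1..n. L ^ (i - 1) * norm (h (x i)) powr p)\<close>
  almost everywhere; integrating gives the estimate. Without assuming forward completeness, the same
  inequality bounds \<open>W\<close>, hence \<open>V (x i)\<close> and by (ii) the velocities on a unit time interval,
  a priori: the solution can only live in a compact subset of \<open>D\<close> provided by (i). It is therefore
  a solution of a system with bounded, globally Lipschitz right-hand side, and unit intervals are concatenated.\<close>

subsection \<open>Absolutely continuous functions on an interval\<close>

text \<open>Solutions are merely absolutely continuous, so integrating the differential inequality
  for \<open>W\<close> takes the fundamental theorem of calculus with an exceptional null set, and
  returning from an integral equation to the differential equation takes almost everywhere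
  differentiation. The estimate is derived for an arbitrary given solution, hence independently of
  how existence is obtained. The obstacle to existence is a circularity: the bound on
  \<open>W\<close> holds only while the solution stays in \<open>D\<close> and solves the original
  system, which is what the bound is meant to ensure. A margin breaks it: the truncated right-hand
  side still agrees with \<open>f\<close> a distance \<open>\<delta>\<close> beyond the compact set,
  staying in that margin forces the solution back into the set, and continuity forbids jumping
  across the gap. The constants have a fixed order: a level for \<open>V\<close>, then the velocity
  bound on that level set, then the radius of the compact set, which allows for the distance
  travelled in unit time. Since the step length 1 does not depend on the state, the steps cannot
  accumulate at a finite time.\<close>

lemma measure_division_of:
  assumes "d division_of X"
  shows "(\<Sum>K\<in>d. measure lborel K) = measure lebesgue X"
proof -
  have "pairwise (\<lambda>S T. negligible (S \<inter> T)) d"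
  proof (rule pairwiseI)
    fix S T assume ST: "S \<in> d" "T \<in> d" "S \<noteq> T"
    then have "convex (S \<inter> T)" "interior (S \<inter> T) = {}"
      using division_ofD[OF assms] by (metis convex_Int convex_box(1), simp)
    then show "negligible (S \<inter> T)"
      by (simp add: negligible_convex_interior)
  qed
  then have "measure lebesgue (\<Union>d) = (\<Sum>S\<in>d. measure lebesgue S)"
    using assms division_ofD(4)[OF assms]
    by (intro measure_negligible_finite_Union) (auto dest: division_of_finite)
  moreover have "measure lebesgue K = measure lborel K" if "K \<in> d" for K
    using division_ofD(4)[OF assms that] by (auto simp: measure_completion)
  ultimately show ?thesis
    using division_ofD(6)[OF assms] by simp
qed

lemma negligible_outer_open:
  fixes N :: "'a::euclidean_space set"
  assumes "negligible N" "\<delta> > 0"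
  obtains U where "open U" "N \<subseteq> U" "U \<in> lmeasurable" "measure lebesgue U < \<delta>"
proof -
  have N: "N \<in> null_sets lebesgue"
    using assms negligible_iff_null_sets by blast
  then obtain U where U: "open U" "N \<subseteq> U" "U - N \<in> lmeasurable" "emeasure lebesgue (U - N) < ennreal \<delta>"
    using sets_lebesgue_outer_open[of N \<delta>] assms(2) by blast
  have "U \<in> lmeasurable"
    using U N by (metis borel_open measurable_Diff_null_set sets_completionI_sets sets_lborel)
  moreover have "emeasure lebesgue U < ennreal \<delta>"
    using U(4) N \<open>U \<in> lmeasurable\<close> by (simp add: emeasure_Diff_null_set fmeasurableD)
  then have "measure lebesgue U < \<delta>"
    using \<open>U \<in> lmeasurable\<close> assms(2) by (simp add: emeasure_eq_measure2 ennreal_less_iff)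
  ultimately show thesis using U that by blast
qed

text \<open>The gauge treats two kinds of tags differently. Off \<open>N\<close> it is the ball on
  which the derivative approximates \<open>F\<close>, so the errors add up to at most a multiple of
  the total length. On \<open>N\<close> it is an open set of measure below \<open>\<delta>\<close>,
  so the intervals tagged there have total length below \<open>\<delta>\<close>, and absolute
  continuity makes their increments small. Mere continuity would not do, as the Cantor function
  shows.\<close>

lemma has_integral_abs_continuous:
  fixes F :: "real \<Rightarrow> 'a::euclidean_space"
  assumes "a \<le> b" and AC: "abs_continuous_on_interval a b F" and "negligible N"
    and deriv: "\<And>t. t \<in> {a..b} - N \<Longrightarrow> (F has_vector_derivative f t) (at t within {a..b})"
  shows "(f has_integral F b - F a) {a..b}"
proof -
  \<comment> \<open>Zero on \<open>N\<close>: terms tagged in \<open>N\<close> then contribute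
    nothing to the Riemann sum, and only the increments of \<open>F\<close> remain to be estimated
    there.\<close>
  define f0 where "f0 t = (if t \<in> N then 0 else f t)" for t
  have "(f0 has_integral F b - F a) {a..b}"
    unfolding has_integral_real
  proof (intro allI impI)
    fix e :: real assume "e > 0"
    \<comment> \<open>Chosen so that \<open>e1\<close> times the total length \<open>b - a\<close>
      is at most \<open>e / 2\<close>; the summand 1 covers \<open>a = b\<close>.\<close>
    define e1 where "e1 = e / (2 * (b - a + 1))"
    have "e1 > 0" using \<open>a \<le> b\<close> \<open>e > 0\<close> by (simp add: e1_def)
    have "\<forall>x. \<exists>d>0. x \<in> {a..b} - N \<longrightarrow>
        (\<forall>y\<in>{a..b}. norm (y-x) < d \<longrightarrow> norm (F y - F x - (y-x) *\<^sub>R f x) \<le> e1 * norm (y-x))"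
      using deriv[unfolded has_vector_derivative_def has_derivative_within_alt] \<open>e1 > 0\<close> zero_less_one by blast
    then obtain d where d: "\<And>x. 0 < d x"
      "\<And>x y. \<lbrakk>x \<in> {a..b} - N; y \<in> {a..b}; norm (y-x) < d x\<rbrakk>
           \<Longrightarrow> norm (F y - F x - (y-x) *\<^sub>R f x) \<le> e1 * norm (y-x)"
      by metis
    obtain \<delta> where "\<delta> > 0" and \<delta>: "\<And>d X. \<lbrakk>d division_of X; X \<subseteq> {a..b}; (\<Sum>K\<in>d. Sup K - Inf K) < \<delta>\<rbrakk> \<Longrightarrow>
        (\<Sum>K\<in>d. norm (F (Sup K) - F (Inf K))) < e / 2"
      using AC \<open>e > 0\<close> unfolding abs_continuous_on_interval_def by (metis half_gt_zero)
    obtain U where U: "open U" "N \<subseteq> U" "U \<in> lmeasurable" "measure lebesgue U < \<delta>"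
      using negligible_outer_open[OF \<open>negligible N\<close> \<open>\<delta> > 0\<close>] by blast
    define \<gamma> where "\<gamma> x = (if x \<in> N then U else ball x (d x))" for x
    have "gauge \<gamma>"
      using U d(1) by (auto simp: gauge_def \<gamma>_def)
    moreover have "norm ((\<Sum>(x, K)\<in>p. measure lborel K *\<^sub>R f0 x) - (F b - F a)) < e"
      if p: "p tagged_division_of {a..b}" "\<gamma> fine p" for p
    proof -
      define q where "q = {z \<in> p. fst z \<in> N}"
      have "finite p" using p by blast
      have qp: "q \<subseteq> p" by (auto simp: q_def)
      have interv: "\<exists>u v. K = {u..v} \<and> u \<le> v \<and> x \<in> K \<and> K \<subseteq> {a..b}" if xK: "(x, K) \<in> p" for x K
      proof -
        have "x \<in> K" "K \<subseteq> {a..b}" "\<exists>u v. K = cbox u v"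
          using tagged_division_ofD(2-4)[OF p(1) xK] by auto
        then show ?thesis by (metis atLeastAtMost_iff box_real(2) order_trans)
      qed
      have ba: "b - a = (\<Sum>(x,K)\<in>p. Sup K - Inf K)" "F b - F a = (\<Sum>(x,K)\<in>p. F (Sup K) - F (Inf K))"
        using additive_tagged_division_1[of a b p "\<lambda>x. x"] additive_tagged_division_1[of a b p F] \<open>a \<le> b\<close> p by auto
      have "q tagged_partial_division_of {a..b}"
        using p(1) qp by (meson tagged_division_of_def tagged_partial_division_subset)
      then have qdiv: "q tagged_division_of \<Union>(snd ` q)"
        by (rule tagged_partial_division_of_Union_self)
      then have sdiv: "(snd ` q) division_of \<Union>(snd ` q)"
        by (rule division_of_tagged_division)
      have "(\<Sum>K\<in>snd ` q. Sup K - Inf K) = (\<Sum>K\<in>snd ` q. measure lborel K)"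
      proof (rule sum.cong[OF refl])
        fix K assume "K \<in> snd ` q"
        then obtain x where "(x, K) \<in> p" using qp by auto
        then show "Sup K - Inf K = measure lborel K" using interv by fastforce
      qed
      also have "\<dots> = measure lebesgue (\<Union>(snd ` q))"
        by (rule measure_division_of[OF sdiv])
      also have "\<dots> \<le> measure lebesgue U"
      proof (rule measure_mono_fmeasurable[OF _ _ U(3)])
        show "\<Union>(snd ` q) \<subseteq> U"
        proof (clarify)
          fix x K y assume "(x, K) \<in> q" "y \<in> snd (x, K)"
          then show "y \<in> U" using p(2) by (fastforce simp: q_def \<gamma>_def fine_def)
        qed
        show "\<Union>(snd ` q) \<in> sets lebesgue"
          using sdiv lmeasurable_division by blast
      qed
      also have "\<dots> < \<delta>" by (rule U)
      finally have "(\<Sum>K\<in>snd ` q. norm (F (Sup K) - F (Inf K))) < e / 2"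
      proof (rule \<delta>[OF sdiv, rotated])
        show "\<Union>(snd ` q) \<subseteq> {a..b}" using interv qp by fastforce
      qed
      moreover have "(\<Sum>(x,K)\<in>q. norm (F (Sup K) - F (Inf K))) = (\<Sum>K\<in>snd ` q. norm (F (Sup K) - F (Inf K)))"
      proof -
        \<comment> \<open>Passing from tagged intervals to the set of intervals requires a function
          that vanishes on degenerate boxes. On one-point intervals the increment of
          \<open>F\<close> already does; the empty box has to be set to 0 because its
          \<open>Sup\<close> and \<open>Inf\<close> carry no information.\<close>
        define D where "D K = (if K = {} then 0 else norm (F (Sup K) - F (Inf K)))" for K
        have "(\<Sum>(x,K)\<in>q. D K) = (\<Sum>K\<in>snd ` q. D K)"
        proof (rule sum.over_tagged_division_lemma[OF qdiv])
          fix u v :: real assume "box u v = {}"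
          then show "D (cbox u v) = 0"
            by (cases "u = v") (auto simp: D_def)
        qed
        moreover have D: "D K = norm (F (Sup K) - F (Inf K))" if "(x, K) \<in> q" for x K
          using that interv qp by (fastforce simp: D_def)
        then have "(\<Sum>(x,K)\<in>q. D K) = (\<Sum>(x,K)\<in>q. norm (F (Sup K) - F (Inf K)))"
          "(\<Sum>K\<in>snd ` q. D K) = (\<Sum>K\<in>snd ` q. norm (F (Sup K) - F (Inf K)))"
          by (auto intro!: sum.cong)
        ultimately show ?thesis by simp
      qed
      ultimately have qsum: "(\<Sum>(x,K)\<in>q. norm (F (Sup K) - F (Inf K))) < e / 2" by simp
      have rest: "(\<Sum>(x,K)\<in>p - q. norm (measure lborel K *\<^sub>R f0 x - (F (Sup K) - F (Inf K)))) \<le> (\<Sum>(x,K)\<in>p - q. e1 * (Sup K - Inf K))"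
      proof (rule sum_mono, clarify)
        fix x K assume xK: "(x, K) \<in> p" "(x, K) \<notin> q"
        obtain u v where k: "K = {u..v}" "u \<le> v" "x \<in> K" and kab: "K \<subseteq> {a..b}"
          using interv[OF xK(1)] by blast
        have xN: "x \<notin> N" using xK by (auto simp: q_def)
        have ball: "\<forall>y\<in>K. y \<in> ball x (d x)"
          using fineD[OF p(2) xK(1)] xN by (auto simp: \<gamma>_def)
        have uv: "u \<in> K" "v \<in> K" using k by auto
        \<comment> \<open>Both endpoints are compared with the tag \<open>x\<close>, which lies
          between them, so the two errors add up to \<open>e1 * (v - u)\<close>.\<close>
        have "norm ((v - u) *\<^sub>R f x - (F v - F u)) = norm (F u - F x - (u - x) *\<^sub>R f x - (F v - F x - (v - x) *\<^sub>R f x))"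
          by (auto simp: algebra_simps)
        also have "\<dots> \<le> norm (F u - F x - (u - x) *\<^sub>R f x) + norm (F v - F x - (v - x) *\<^sub>R f x)"
          by (rule norm_triangle_ineq4)
        also have "\<dots> \<le> e1 * norm (u - x) + e1 * norm (v - x)"
        proof -
          have "norm (u - x) < d x" "norm (v - x) < d x"
            using ball uv by (auto simp: dist_real_def)
          then show ?thesis
            using uv kab k(3) xN by (intro add_mono d(2)) auto
        qed
        also have "\<dots> = e1 * (v - u)"
          using k by (auto simp: algebra_simps)
        finally show "norm (measure lborel K *\<^sub>R f0 x - (F (Sup K) - F (Inf K))) \<le> e1 * (Sup K - Inf K)"
          using k xN by (simp add: f0_def)
      qed
      have "(\<Sum>(x, K)\<in>p. measure lborel K *\<^sub>R f0 x) - (F b - F a) = (\<Sum>(x,K)\<in>p. measure lborel K *\<^sub>R f0 x - (F (Sup K) - F (Inf K)))"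
        by (simp add: ba split_def sum_subtractf)
      then have "norm ((\<Sum>(x, K)\<in>p. measure lborel K *\<^sub>R f0 x) - (F b - F a))
          \<le> (\<Sum>(x,K)\<in>p. norm (measure lborel K *\<^sub>R f0 x - (F (Sup K) - F (Inf K))))"
        by (simp add: split_def norm_sum)
      also have "\<dots> = (\<Sum>(x,K)\<in>p - q. norm (measure lborel K *\<^sub>R f0 x - (F (Sup K) - F (Inf K))))
          + (\<Sum>(x,K)\<in>q. norm (measure lborel K *\<^sub>R f0 x - (F (Sup K) - F (Inf K))))"
        by (rule sum.subset_diff[OF qp \<open>finite p\<close>])
      also have "(\<Sum>(x,K)\<in>q. norm (measure lborel K *\<^sub>R f0 x - (F (Sup K) - F (Inf K)))) = (\<Sum>(x,K)\<in>q. norm (F (Sup K) - F (Inf K)))"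
        by (rule sum.cong) (auto simp: q_def f0_def norm_minus_commute)
      also have "(\<Sum>(x,K)\<in>p - q. norm (measure lborel K *\<^sub>R f0 x - (F (Sup K) - F (Inf K)))) + \<dots>
          < (\<Sum>(x,K)\<in>p - q. e1 * (Sup K - Inf K)) + e / 2"
        using rest qsum by linarith
      also have "(\<Sum>(x,K)\<in>p - q. e1 * (Sup K - Inf K)) \<le> (\<Sum>(x,K)\<in>p. e1 * (Sup K - Inf K))"
      proof (rule sum_mono2[OF \<open>finite p\<close>])
        fix z assume "z \<in> p - (p - q)"
        then obtain x K where "z = (x, K)" "(x, K) \<in> p" by (cases z) auto
        then show "0 \<le> (case z of (x, K) \<Rightarrow> e1 * (Sup K - Inf K))"
          using interv[of x K] \<open>e1 > 0\<close> by auto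
      qed auto
      also have "\<dots> = e1 * (b - a)"
        by (simp add: ba(1) sum_distrib_left split_def)
      also have "\<dots> \<le> e / 2"
        using \<open>a \<le> b\<close> \<open>e > 0\<close> by (simp add: e1_def field_simps)
      finally show ?thesis by simp
    qed
    ultimately show "\<exists>\<gamma>. gauge \<gamma> \<and> (\<forall>\<D>. \<D> tagged_division_of {a..b} \<and> \<gamma> fine \<D> \<longrightarrow>
        norm ((\<Sum>(x, K)\<in>\<D>. measure lborel K *\<^sub>R f0 x) - (F b - F a)) < e)"
      by (intro exI[of _ \<gamma>]) simp
  qed
  then show ?thesis
    using has_integral_spike[OF \<open>negligible N\<close>, of "{a..b}" f f0] by (simp add: f0_def)
qed

section \<open>Criteria for absolute continuity\<close>

lemma abs_continuous_on_interval_subset: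
  assumes "abs_continuous_on_interval a b F" "{a'..b'} \<subseteq> {a..b}"
  shows "abs_continuous_on_interval a' b' F"
  using assms unfolding abs_continuous_on_interval_def by (meson subset_trans)

lemma division_Inf_Sup:
  fixes X :: "real set"
  assumes "d division_of X" "X \<subseteq> {a..b}" "K \<in> d"
  shows "Inf K \<le> Sup K" "Inf K \<in> {a..b}" "Sup K \<in> {a..b}"
proof -
  obtain u v where "K = {u..v}" "u \<le> v" "K \<subseteq> {a..b}"
    using division_ofD(2-4)[OF assms(1,3)] assms(2)
    by (metis atLeastatMost_empty_iff2 box_real(2) subset_trans)
  then show "Inf K \<le> Sup K" "Inf K \<in> {a..b}" "Sup K \<in> {a..b}" by auto
qed

lemma lipschitz_imp_abs_continuous:
  fixes F :: "real \<Rightarrow> 'a::euclidean_space"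
  assumes "M-lipschitz_on {a..b} F"
  shows "abs_continuous_on_interval a b F"
  unfolding abs_continuous_on_interval_def
proof (intro allI impI)
  fix e :: real assume "e > 0"
  have "M \<ge> 0" using assms lipschitz_on_nonneg by blast
  show "\<exists>\<delta>>0. \<forall>d X. d division_of X \<and> X \<subseteq> {a..b} \<and> (\<Sum>K\<in>d. Sup K - Inf K) < \<delta> \<longrightarrow>
       (\<Sum>K\<in>d. norm (F (Sup K) - F (Inf K))) < e"
  proof (intro exI[of _ "e / (M + 1)"] conjI allI impI; (elim conjE)?)
    show "e / (M + 1) > 0" using \<open>e > 0\<close> \<open>M \<ge> 0\<close> by simp
    fix d and X :: "real set"
    assume d: "d division_of X" "X \<subseteq> {a..b}" "(\<Sum>K\<in>d. Sup K - Inf K) < e / (M + 1)"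
    have "(\<Sum>K\<in>d. norm (F (Sup K) - F (Inf K))) \<le> (\<Sum>K\<in>d. M * (Sup K - Inf K))"
    proof (rule sum_mono)
      fix K assume "K \<in> d"
      with division_Inf_Sup[OF d(1,2)] show "norm (F (Sup K) - F (Inf K)) \<le> M * (Sup K - Inf K)"
        using lipschitz_onD[OF assms, of "Sup K" "Inf K"] by (simp add: dist_norm)
    qed
    also have "\<dots> = M * (\<Sum>K\<in>d. Sup K - Inf K)"
      by (simp add: sum_distrib_left)
    also have "\<dots> \<le> M * (e / (M + 1))"
      using d(3) \<open>M \<ge> 0\<close> by (intro mult_left_mono) auto
    also have "\<dots> < e"
      using \<open>M \<ge> 0\<close> \<open>e > 0\<close> by (simp add: field_simps)
    finally show "(\<Sum>K\<in>d. norm (F (Sup K) - F (Inf K))) < e" .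
  qed
qed

text \<open>Finitely many functions admit a common \<open>\<delta>\<close>, and the budget
  \<open>e\<close> is shared out in proportion to the weights \<open>M i\<close>. The case needed
  later is the storage along a trajectory, whose increments are dominated by those of the
  components.\<close>

lemma abs_continuous_sum_bound:
  fixes F :: "real \<Rightarrow> 'a::euclidean_space" and x :: "'i \<Rightarrow> real \<Rightarrow> 'b::euclidean_space"
  assumes "finite I" and x: "\<And>i. i \<in> I \<Longrightarrow> abs_continuous_on_interval a b (x i)"
    and M: "\<And>i. i \<in> I \<Longrightarrow> 0 \<le> M i"
    and le: "\<And>s t. s \<in> {a..b} \<Longrightarrow> t \<in> {a..b} \<Longrightarrow> norm (F s - F t) \<le> (\<Sum>i\<in>I. M i * norm (x i s - x i t))"
  shows "abs_continuous_on_interval a b F"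
  unfolding abs_continuous_on_interval_def
proof (intro allI impI)
  fix e :: real assume "e > 0"
  define S where "S = (\<Sum>i\<in>I. M i)"
  have "S \<ge> 0" using M by (simp add: S_def sum_nonneg)
  define e1 where "e1 = e / (S + 1)"
  have "e1 > 0" using \<open>e > 0\<close> \<open>S \<ge> 0\<close> by (simp add: e1_def)
  have "\<forall>i\<in>I. \<exists>\<delta>>0. \<forall>d X. d division_of X \<and> X \<subseteq> {a..b} \<and> (\<Sum>K\<in>d. Sup K - Inf K) < \<delta> \<longrightarrow>
       (\<Sum>K\<in>d. norm (x i (Sup K) - x i (Inf K))) < e1"
    using x \<open>e1 > 0\<close> unfolding abs_continuous_on_interval_def by blast
  from bchoice[OF this] obtain \<delta> where "\<forall>i\<in>I. \<delta> i > 0 \<and> (\<forall>d X. d division_of X \<and> X \<subseteq> {a..b} \<and>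
       (\<Sum>K\<in>d. Sup K - Inf K) < \<delta> i \<longrightarrow> (\<Sum>K\<in>d. norm (x i (Sup K) - x i (Inf K))) < e1)"
    by blast
  then have \<delta>: "\<And>i. i \<in> I \<Longrightarrow> \<delta> i > 0"
    "\<And>i d X. \<lbrakk>i \<in> I; d division_of X; X \<subseteq> {a..b}; (\<Sum>K\<in>d. Sup K - Inf K) < \<delta> i\<rbrakk> \<Longrightarrow>
       (\<Sum>K\<in>d. norm (x i (Sup K) - x i (Inf K))) < e1"
    by (simp, meson)
  \<comment> \<open>The element 1 keeps the minimum meaningful when \<open>I\<close> is
    empty.\<close>
  define \<delta>0 where "\<delta>0 = Min (insert 1 (\<delta> ` I))"
  have "\<delta>0 > 0" "\<And>i. i \<in> I \<Longrightarrow> \<delta>0 \<le> \<delta> i"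
    using \<open>finite I\<close> \<delta>(1) by (auto simp: \<delta>0_def)
  show "\<exists>\<delta>>0. \<forall>d X. d division_of X \<and> X \<subseteq> {a..b} \<and> (\<Sum>K\<in>d. Sup K - Inf K) < \<delta> \<longrightarrow>
       (\<Sum>K\<in>d. norm (F (Sup K) - F (Inf K))) < e"
  proof (intro exI[of _ \<delta>0] conjI allI impI; (elim conjE)?)
    show "\<delta>0 > 0" by fact
    fix d and X :: "real set"
    assume d: "d division_of X" "X \<subseteq> {a..b}" "(\<Sum>K\<in>d. Sup K - Inf K) < \<delta>0"
    have "(\<Sum>K\<in>d. norm (F (Sup K) - F (Inf K))) \<le> (\<Sum>K\<in>d. \<Sum>i\<in>I. M i * norm (x i (Sup K) - x i (Inf K)))"
      using division_Inf_Sup[OF d(1,2)] by (intro sum_mono le) auto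
    also have "\<dots> = (\<Sum>i\<in>I. M i * (\<Sum>K\<in>d. norm (x i (Sup K) - x i (Inf K))))"
      by (subst sum.swap) (simp add: sum_distrib_left)
    also have "\<dots> \<le> (\<Sum>i\<in>I. M i * e1)"
    proof (intro sum_mono mult_left_mono M)
      fix i assume "i \<in> I"
      with d(3) \<open>\<And>i. i \<in> I \<Longrightarrow> \<delta>0 \<le> \<delta> i\<close> have "(\<Sum>K\<in>d. Sup K - Inf K) < \<delta> i" by (meson less_le_trans)
      then show "(\<Sum>K\<in>d. norm (x i (Sup K) - x i (Inf K))) \<le> e1"
        using \<delta>(2)[OF \<open>i \<in> I\<close> d(1,2)] by simp
    qed
    also have "\<dots> = S * e1" by (simp add: S_def sum_distrib_right)
    also have "\<dots> < e"
      using \<open>S \<ge> 0\<close> \<open>e > 0\<close> by (simp add: e1_def field_simps)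
    finally show "(\<Sum>K\<in>d. norm (F (Sup K) - F (Inf K))) < e" .
  qed
qed

lemma abs_continuous_imp_continuous_on:
  fixes F :: "real \<Rightarrow> 'a::euclidean_space"
  assumes "abs_continuous_on_interval a b F"
  shows "continuous_on {a..b} F"
  unfolding continuous_on_iff
proof (intro ballI allI impI)
  fix s e :: real assume s: "s \<in> {a..b}" "e > 0"
  then obtain \<delta> where "\<delta> > 0" and \<delta>: "\<And>d X. \<lbrakk>d division_of X; X \<subseteq> {a..b}; (\<Sum>K\<in>d. Sup K - Inf K) < \<delta>\<rbrakk> \<Longrightarrow>
      (\<Sum>K\<in>d. norm (F (Sup K) - F (Inf K))) < e"
    using assms unfolding abs_continuous_on_interval_def by metis
  have one: "dist (F v) (F u) < e" if "u \<in> {a..b}" "v \<in> {a..b}" "u \<le> v" "v - u < \<delta>" for u v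
    using \<delta>[of "{{u..v}}" "{u..v}"] that division_of_self[of u v] by (auto simp: dist_norm)
  show "\<exists>d>0. \<forall>x'\<in>{a..b}. dist x' s < d \<longrightarrow> dist (F x') (F s) < e"
  proof (intro exI[of _ \<delta>] conjI ballI impI)
    fix t assume t: "t \<in> {a..b}" "dist t s < \<delta>"
    then show "dist (F t) (F s) < e"
      using one[of s t] one[of t s] s(1) by (cases "s \<le> t") (auto simp: dist_real_def dist_commute)
  qed (rule \<open>\<delta> > 0\<close>)
qed

section \<open>Almost everywhere derivatives of indefinite integrals\<close>

text \<open>The library's differentiation theorem is one-sided; the left derivative comes from reflection.\<close>

lemma indefinite_integral_has_vector_derivative_right:
  fixes x G :: "real \<Rightarrow> 'a::euclidean_space"
  assumes int: "\<And>a b. \<lbrakk>\<alpha> \<le> a; a \<le> b; b \<le> \<beta>\<rbrakk> \<Longrightarrow> (G has_integral x b - x a) {a..b}"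
  obtains N where "negligible N"
    "\<And>t e. \<lbrakk>t \<in> {\<alpha><..<\<beta>} - N; 0 < e\<rbrakk> \<Longrightarrow> \<exists>d>0. \<forall>h. 0 < h \<and> h < d \<longrightarrow> norm (x (t + h) - x t - h *\<^sub>R G t) \<le> e * h"
proof -
  \<comment> \<open>Extension by zero makes the integrand integrable over every box, as the
    differentiation theorem requires; taking \<open>h < \<beta> - t\<close> below keeps
    \<open>t + h\<close> where \<open>g\<close> and \<open>G\<close> agree.\<close>
  define g where "g t = (if t \<in> {\<alpha>..\<beta>} then G t else 0)" for t
  have "G integrable_on {\<alpha>..\<beta>}"
    using int[of \<alpha> \<beta>] by (cases "\<alpha> \<le> \<beta>") (auto simp: integrable_on_def)
  then have "g integrable_on UNIV"
    unfolding g_def integrable_restrict_UNIV .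
  then have "g integrable_on cbox a b" for a b
    by (rule integrable_on_subcbox) simp
  then obtain N where N: "negligible N"
    "\<And>t e. \<lbrakk>t \<notin> N; 0 < e\<rbrakk> \<Longrightarrow> \<exists>d>0. \<forall>h. 0 < h \<and> h < d \<longrightarrow>
        norm (integral (cbox t (t + h *\<^sub>R One)) g /\<^sub>R h ^ DIM(real) - g t) < e"
    using integrable_ccontinuous_explicit[of g] by blast
  show thesis
  proof (rule that[OF N(1)])
    fix t e :: real assume t: "t \<in> {\<alpha><..<\<beta>} - N" and "0 < e"
    obtain d where "d > 0" and d: "\<And>h. 0 < h \<Longrightarrow> h < d \<Longrightarrow> norm (integral {t..t + h} g /\<^sub>R h - g t) < e"
      using N(2)[of t e] t \<open>0 < e\<close> by auto
    show "\<exists>d>0. \<forall>h. 0 < h \<and> h < d \<longrightarrow> norm (x (t + h) - x t - h *\<^sub>R G t) \<le> e * h"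
    proof (intro exI[of _ "min d (\<beta> - t)"] conjI allI impI)
      show "min d (\<beta> - t) > 0" using \<open>d > 0\<close> t by auto
      fix h assume h: "0 < h \<and> h < min d (\<beta> - t)"
      have "(g has_integral x (t + h) - x t) {t..t + h}"
        using int[of t "t + h"] h t
        by (subst has_integral_cong[of _ _ G]) (auto simp: g_def)
      then have "integral {t..t + h} g = x (t + h) - x t" by blast
      then have "norm ((x (t + h) - x t) /\<^sub>R h - G t) < e"
        using d[of h] h t by (simp add: g_def)
      moreover have "(x (t + h) - x t) - h *\<^sub>R G t = h *\<^sub>R ((x (t + h) - x t) /\<^sub>R h - G t)"
        using h by (simp add: scaleR_diff_right)
      ultimately show "norm (x (t + h) - x t - h *\<^sub>R G t) \<le> e * h"
        using h by simp
    qed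
  qed
qed

lemma indefinite_integral_has_vector_derivative_ae:
  fixes x G :: "real \<Rightarrow> 'a::euclidean_space"
  assumes int: "\<And>a b. \<lbrakk>\<alpha> \<le> a; a \<le> b; b \<le> \<beta>\<rbrakk> \<Longrightarrow> (G has_integral x b - x a) {a..b}"
  obtains N where "negligible N"
    "\<And>t. t \<in> {\<alpha><..<\<beta>} - N \<Longrightarrow> (x has_vector_derivative G t) (at t)"
proof -
  obtain N1 where N1: "negligible N1"
    "\<And>t e. \<lbrakk>t \<in> {\<alpha><..<\<beta>} - N1; 0 < e\<rbrakk> \<Longrightarrow> \<exists>d>0. \<forall>h. 0 < h \<and> h < d \<longrightarrow> norm (x (t + h) - x t - h *\<^sub>R G t) \<le> e * h"
    using indefinite_integral_has_vector_derivative_right[OF int] by blast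
  \<comment> \<open>The function \<open>- x (- s)\<close> is a primitive of \<open>G (- s)\<close>,
    and its right derivative at \<open>s = - t\<close> is the left derivative of \<open>x\<close> at
    \<open>t\<close>.\<close>
  have int': "((\<lambda>t. G (- t)) has_integral (- x (- b)) - (- x (- a))) {a..b}"
    if "-\<beta> \<le> a" "a \<le> b" "b \<le> -\<alpha>" for a b
    using has_integral_reflect_lemma_real[OF int[of "-b" "-a"]] that by simp
  obtain N2 where N2: "negligible N2"
    "\<And>t e. \<lbrakk>t \<in> {-\<beta><..<-\<alpha>} - N2; 0 < e\<rbrakk> \<Longrightarrow>
       \<exists>d>0. \<forall>h. 0 < h \<and> h < d \<longrightarrow> norm (- x (- (t + h)) - (- x (- t)) - h *\<^sub>R G (- t)) \<le> e * h"
    using indefinite_integral_has_vector_derivative_right[of "-\<beta>" "-\<alpha>" "\<lambda>t. G (- t)" "\<lambda>t. - x (- t)", OF int'] by blast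
  show thesis
  proof
    show "negligible (N1 \<union> uminus ` N2)"
      using N1(1) N2(1)
      by (intro negligible_Un negligible_differentiable_image_negligible) (auto intro!: differentiable_on_minus)
    fix t assume t: "t \<in> {\<alpha><..<\<beta>} - (N1 \<union> uminus ` N2)"
    then have t2: "- t \<in> {-\<beta><..<-\<alpha>} - N2" by force
    show "(x has_vector_derivative G t) (at t)"
      unfolding has_vector_derivative_def has_derivative_at_alt
    proof (intro conjI allI impI)
      show "bounded_linear (\<lambda>u. u *\<^sub>R G t)" by (rule bounded_linear_scaleR_left)
      fix e :: real assume "e > 0"
      obtain d1 where d1: "d1 > 0" "\<And>h. 0 < h \<Longrightarrow> h < d1 \<Longrightarrow> norm (x (t + h) - x t - h *\<^sub>R G t) \<le> e * h"
        using N1(2)[of t e] t \<open>e > 0\<close> by auto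
      obtain d2 where d2: "d2 > 0" "\<And>h. 0 < h \<Longrightarrow> h < d2 \<Longrightarrow> norm (- x (t - h) + x t - h *\<^sub>R G t) \<le> e * h"
        using N2(2)[OF t2 \<open>e > 0\<close>] by auto
      show "\<exists>d>0. \<forall>y. norm (y - t) < d \<longrightarrow> norm (x y - x t - (y - t) *\<^sub>R G t) \<le> e * norm (y - t)"
      proof (intro exI[of _ "min d1 d2"] conjI allI impI)
        show "min d1 d2 > 0" using d1 d2 by simp
        fix y assume y: "norm (y - t) < min d1 d2"
        consider "y = t" | "y > t" | "y < t" by linarith
        then show "norm (x y - x t - (y - t) *\<^sub>R G t) \<le> e * norm (y - t)"
        proof cases
          case 2 then show ?thesis using d1(2)[of "y - t"] y by auto
        next
          case 3
          then have "norm (- x y + x t - (t - y) *\<^sub>R G t) \<le> e * (t - y)"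
            using d2(2)[of "t - y"] y by auto
          moreover have "x y - x t - (y - t) *\<^sub>R G t = - (- x y + x t - (t - y) *\<^sub>R G t)"
            by (simp add: algebra_simps)
          ultimately show ?thesis using 3 by (metis norm_minus_cancel abs_of_neg diff_gt_0_iff_gt minus_diff_eq neg_less_0_iff_less real_norm_def)
        qed auto
      qed
    qed
  qed
qed

subsection \<open>Caratheodory solutions for bounded Lipschitz right-hand sides\<close>

text \<open>A whole family of trajectories is to be a single point of the complete space of bounded
  continuous functions. Making the component index a discrete space achieves this: each slice
  \<open>{j} \<times> UNIV\<close> is open, so continuity can be checked one component at a
  time.\<close>

lemma continuous_on_discrete_prod:
  fixes F :: "'i discrete \<times> 'a::topological_space \<Rightarrow> 'b::topological_space"
  assumes "\<And>j. continuous_on UNIV (\<lambda>t. F (j, t))"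
  shows "continuous_on UNIV F"
proof -
  have "continuous_on (\<Union>j. {j} \<times> (UNIV :: 'a set)) F"
  proof (rule continuous_on_open_UN)
    fix j :: "'i discrete"
    show "open ({j} \<times> (UNIV :: 'a set))"
      by (intro open_Times Discrete_Topology.open_discrete open_UNIV)
    have "continuous_on ({j} \<times> UNIV) ((\<lambda>t. F (j, t)) \<circ> snd)"
      by (intro continuous_on_compose continuous_on_snd continuous_on_id continuous_on_subset[OF assms]) auto
    then show "continuous_on ({j} \<times> UNIV) F"
      by (subst continuous_on_cong[of _ "{j} \<times> UNIV" F "(\<lambda>t. F (j, t)) \<circ> snd"]) auto
  qed
  moreover have "(\<Union>j::'i discrete. {j} \<times> (UNIV :: 'a set)) = UNIV" by auto
  ultimately show ?thesis by (simp only:)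
qed

text \<open>Banach's fixed point theorem in the Bielecki weighted sup norm: the iteration acts on
  \<open>exp (- \<lambda> t) *\<^sub>R x t\<close>, which makes it a contraction on the whole interval.\<close>

lemma caratheodory_picard:
  fixes R :: "real \<Rightarrow> (nat \<Rightarrow> 'a::euclidean_space) \<Rightarrow> nat \<Rightarrow> 'a" and T \<Lambda> B :: real
  assumes "finite I" "0 \<le> T" "0 \<le> \<Lambda>" "0 \<le> B"
    and int: "\<And>y i. \<lbrakk>i \<in> I; \<And>j. j \<in> I \<Longrightarrow> continuous_on {0..T} (\<lambda>t. y t j)\<rbrakk>
        \<Longrightarrow> (\<lambda>t. R t (y t) i) integrable_on {0..T}"
    and bound: "\<And>t z i. i \<in> I \<Longrightarrow> norm (R t z i) \<le> B"
    and lip: "\<And>t z z' i e. \<lbrakk>i \<in> I; \<And>j. j \<in> I \<Longrightarrow> norm (z j - z' j) \<le> e\<rbrakk>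
        \<Longrightarrow> norm (R t z i - R t z' i) \<le> \<Lambda> * e"
  obtains x where "\<And>i. i \<in> I \<Longrightarrow> continuous_on {0..T} (\<lambda>t. x t i)"
    "\<And>i t. \<lbrakk>i \<in> I; t \<in> {0..T}\<rbrakk> \<Longrightarrow> ((\<lambda>s. R s (x s) i) has_integral (x t i - \<xi> i)) {0..t}"
proof -
  \<comment> \<open>Any weight rate above \<open>\<Lambda>\<close> works: the contraction constant
    will be \<open>\<Lambda> / \<mu> < 1\<close>. Adding 1 also keeps \<open>\<mu>\<close> positive
    when \<open>\<Lambda> = 0\<close>.\<close>
  define \<mu> where "\<mu> = \<Lambda> + 1"
  have "\<mu> > 0" using \<open>0 \<le> \<Lambda>\<close> by (simp add: \<mu>_def)
  \<comment> \<open>\<open>X y\<close> is the trajectory represented by the weighted function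
    \<open>y\<close>; the weight is undone here.\<close>
  define X :: "((nat discrete \<times> real) \<Rightarrow>\<^sub>C 'a) \<Rightarrow> real \<Rightarrow> nat \<Rightarrow> 'a"
    where "X y t j = exp (\<mu> * t) *\<^sub>R apply_bcontfun y (discrete j, t)" for y t j
  \<comment> \<open>Bounded continuous functions live on the whole line, so time is clamped to
    \<open>{0..T}\<close>, outside of which \<open>\<Psi> y\<close> is constant.\<close>
  define cl where "cl t = max 0 (min T t)" for t
  have cl: "cl t \<in> {0..T}" for t using \<open>0 \<le> T\<close> by (auto simp: cl_def)
  have cl_cont: "continuous_on UNIV cl" unfolding cl_def by (intro continuous_intros)
  define \<Psi> where "\<Psi> y = (\<lambda>(k, t). if of_discrete k \<in> I then exp (- \<mu> * cl t) *\<^sub>R (\<xi> (of_discrete k) + integral {0..cl t} (\<lambda>s. R s (X y s) (of_discrete k))) else 0)" for y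
  have Xcont: "continuous_on S (\<lambda>t. X y t j)" for S y j
    unfolding X_def
    by (intro continuous_intros continuous_on_compose2[OF continuous_on_apply_bcontfun[of UNIV]]) auto
  have Rint: "(\<lambda>s. R s (X y s) j) integrable_on {0..T}" if "j \<in> I" for y j
    by (rule int[OF that Xcont])
  have Rint': "(\<lambda>s. R s (X y s) j) integrable_on {0..cl t}" if "j \<in> I" for y j t
    using cl[of t] by (intro integrable_on_subinterval[OF Rint[OF that]]) auto
  have "\<Psi> y \<in> bcontfun" for y
  proof (rule bcontfun_normI)
    show "continuous_on UNIV (\<Psi> y)"
    proof (rule continuous_on_discrete_prod)
      fix k :: "nat discrete"
      define j where "j = of_discrete k"
      show "continuous_on UNIV (\<lambda>t. \<Psi> y (k, t))"
      proof (cases "j \<in> I")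
        case True
        have "continuous_on UNIV (\<lambda>t. integral {0..cl t} (\<lambda>s. R s (X y s) j))"
          using cl by (intro continuous_on_compose2[OF indefinite_integral_continuous_1[OF Rint[OF True]] cl_cont]) auto
        with True show ?thesis
          unfolding \<Psi>_def j_def by (simp, intro continuous_intros cl_cont)
      qed (simp add: \<Psi>_def j_def)
    qed
    fix jt :: "nat discrete \<times> real"
    obtain j t where jt: "jt = (discrete j, t)" by (cases jt, metis of_discrete_inverse)
    show "norm (\<Psi> y jt) \<le> (\<Sum>j\<in>I. norm (\<xi> j)) + B * T"
    proof (cases "j \<in> I")
      case True
      have "norm (integral {0..cl t} (\<lambda>s. R s (X y s) j)) \<le> B * measure lborel {0..cl t}"
        by (rule has_integral_bound_real[OF \<open>0 \<le> B\<close> finite.emptyI integrable_integral[OF Rint'[OF True]]])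
           (rule bound[OF True])
      also have "\<dots> = B * cl t" using cl[of t] by simp
      also have "\<dots> \<le> B * T" using cl[of t] \<open>0 \<le> B\<close> by (auto intro: mult_left_mono)
      finally have 1: "norm (integral {0..cl t} (\<lambda>s. R s (X y s) j)) \<le> B * T" .
      have 2: "norm (\<xi> j) \<le> (\<Sum>j\<in>I. norm (\<xi> j))"
        using True \<open>finite I\<close> by (intro member_le_sum) auto
      have 3: "exp (- \<mu> * cl t) \<le> 1" using cl[of t] \<open>\<mu> > 0\<close> by auto
      have "norm (\<Psi> y jt) = exp (- \<mu> * cl t) * norm (\<xi> j + integral {0..cl t} (\<lambda>s. R s (X y s) j))"
        using True by (simp add: \<Psi>_def jt discrete_inverse)
      also have "\<dots> \<le> 1 * norm (\<xi> j + integral {0..cl t} (\<lambda>s. R s (X y s) j))"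
        by (intro mult_right_mono 3) auto
      also have "\<dots> \<le> norm (\<xi> j) + norm (integral {0..cl t} (\<lambda>s. R s (X y s) j))"
        using norm_triangle_ineq by simp
      finally show ?thesis using 1 2 by linarith
    next
      case False
      then show ?thesis using \<open>0 \<le> T\<close> \<open>0 \<le> B\<close> by (simp add: \<Psi>_def jt discrete_inverse sum_nonneg)
    qed
  qed
  then have app: "apply_bcontfun (Bcontfun (\<Psi> y)) = \<Psi> y" for y
    by (simp add: Bcontfun_inverse)
  have "dist (Bcontfun (\<Psi> y)) (Bcontfun (\<Psi> y')) \<le> \<Lambda> / \<mu> * dist y y'" for y y'
  proof (rule dist_bound)
    fix jt :: "nat discrete \<times> real"
    obtain j t where jt: "jt = (discrete j, t)" by (cases jt, metis of_discrete_inverse)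
    define d where "d = dist y y'"
    have "d \<ge> 0" by (simp add: d_def)
    show "dist (apply_bcontfun (Bcontfun (\<Psi> y)) jt) (apply_bcontfun (Bcontfun (\<Psi> y')) jt) \<le> \<Lambda> / \<mu> * dist y y'"
    proof (cases "j \<in> I")
      case True
      define J where "J = integral {0..cl t} (\<lambda>s. R s (X y s) j) - integral {0..cl t} (\<lambda>s. R s (X y' s) j)"
      have J: "J = integral {0..cl t} (\<lambda>s. R s (X y s) j - R s (X y' s) j)"
        unfolding J_def by (rule integral_diff[symmetric]) (intro Rint' True)+
      \<comment> \<open>The two trajectories differ by at most \<open>exp (\<mu> * s) * d\<close> at
        time \<open>s\<close>. Integrating this exponential produces the factor
        \<open>1 / \<mu>\<close>, and the weight \<open>exp (- \<mu> * cl t)\<close> then cancels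
        the exponential, uniformly in \<open>t\<close>.\<close>
      have ftc: "((\<lambda>s. \<Lambda> * (exp (\<mu> * s) * d)) has_integral
          (\<Lambda> * d / \<mu> * exp (\<mu> * cl t) - \<Lambda> * d / \<mu> * exp (\<mu> * 0))) {0..cl t}"
        using cl[of t] \<open>\<mu> > 0\<close>
        by (intro fundamental_theorem_of_calculus)
           (auto intro!: derivative_eq_intros simp: has_real_derivative_iff_has_vector_derivative[symmetric])
      have "norm (R s (X y s) j - R s (X y' s) j) \<le> \<Lambda> * (exp (\<mu> * s) * d)" for s
      proof (rule lip[OF True])
        fix i
        have "norm (X y s i - X y' s i) = exp (\<mu> * s) * dist (apply_bcontfun y (discrete i, s)) (apply_bcontfun y' (discrete i, s))"
          unfolding X_def scaleR_diff_right[symmetric] by (simp add: dist_norm)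
        then show "norm (X y s i - X y' s i) \<le> exp (\<mu> * s) * d"
          by (simp add: d_def dist_bounded)
      qed
      then have "norm J \<le> integral {0..cl t} (\<lambda>s. \<Lambda> * (exp (\<mu> * s) * d))"
        unfolding J using ftc
        by (intro integral_norm_bound_integral integrable_diff Rint' True) auto
      also have "\<dots> = \<Lambda> * d / \<mu> * exp (\<mu> * cl t) - \<Lambda> * d / \<mu>"
        using integral_unique[OF ftc] by simp
      also have "\<dots> \<le> \<Lambda> * d / \<mu> * exp (\<mu> * cl t)"
        using \<open>0 \<le> \<Lambda>\<close> \<open>d \<ge> 0\<close> \<open>\<mu> > 0\<close> by simp
      finally have "exp (- \<mu> * cl t) * norm J \<le> exp (- \<mu> * cl t) * (\<Lambda> * d / \<mu> * exp (\<mu> * cl t))"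
        by (intro mult_left_mono) auto
      also have "\<dots> = \<Lambda> / \<mu> * d"
        by (simp add: exp_minus field_simps)
      finally have "exp (- \<mu> * cl t) * norm J \<le> \<Lambda> / \<mu> * d" .
      moreover have "\<Psi> y jt - \<Psi> y' jt = exp (- \<mu> * cl t) *\<^sub>R J"
        using True by (simp add: \<Psi>_def jt discrete_inverse J_def scaleR_diff_right[symmetric])
      ultimately show ?thesis
        by (simp add: app dist_norm d_def)
    qed (use \<open>0 \<le> \<Lambda>\<close> \<open>\<mu> > 0\<close> in \<open>simp only: app, simp add: \<Psi>_def jt discrete_inverse\<close>)
  qed
  moreover have "0 \<le> \<Lambda> / \<mu>" "\<Lambda> / \<mu> < 1"
    using \<open>0 \<le> \<Lambda>\<close> by (auto simp: \<mu>_def)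
  ultimately obtain y where y: "Bcontfun (\<Psi> y) = y"
    using banach_fix_type[of "\<Lambda> / \<mu>" "\<lambda>y. Bcontfun (\<Psi> y)"] by blast
  show thesis
  proof
    show "continuous_on {0..T} (\<lambda>t. X y t i)" for i by (rule Xcont)
    fix i t assume i: "i \<in> I" and t: "t \<in> {0..T}"
    have "cl t = t" using t by (auto simp: cl_def)
    have "apply_bcontfun y (discrete i, t) = \<Psi> y (discrete i, t)" using app[of y] y by simp
    then have "X y t i = \<xi> i + integral {0..t} (\<lambda>s. R s (X y s) i)"
      using i by (simp add: discrete_inverse \<Psi>_def X_def \<open>cl t = t\<close> exp_minus_inverse)
    then have "integral {0..t} (\<lambda>s. R s (X y s) i) = X y t i - \<xi> i" by simp
    then show "((\<lambda>s. R s (X y s) i) has_integral X y t i - \<xi> i) {0..t}"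
      using Rint'[OF i, of y t] by (simp add: has_integral_iff \<open>cl t = t\<close>)
  qed
qed

section \<open>Lipschitz extension from compact sets\<close>

lemma lipschitz_on_compact:
  fixes f :: "'a::metric_space \<Rightarrow> 'b::metric_space"
  assumes f: "locally_lipschitz_on X f" and C: "compact C" "C \<subseteq> X"
  obtains M where "M-lipschitz_on C f"
proof -
  \<comment> \<open>The autonomous \<open>f\<close> is regarded as a time-dependent family over the
    one-point time set \<open>{0}\<close>, to which the compactness theorem for
    \<open>local_lipschitz\<close> applies.\<close>
  have "local_lipschitz {0::real} C (\<lambda>t. f)"
    unfolding local_lipschitz_def
  proof (intro ballI)
    fix x t assume "x \<in> C"
    then obtain e M where "e > 0" "M-lipschitz_on (cball x e \<inter> X) f"
      using f C unfolding locally_lipschitz_on_def by blast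
    then have "M-lipschitz_on (cball x e \<inter> C) f"
      using C(2) by (meson Int_mono lipschitz_on_subset order_refl)
    then show "\<exists>u>0. \<exists>L. \<forall>t\<in>cball t u \<inter> {0::real}. L-lipschitz_on (cball x u \<inter> C) f"
      using \<open>e > 0\<close> by blast
  qed
  then show thesis
    using local_lipschitz_compact_implies_lipschitz[where X = C and T = "{0::real}" and f = "\<lambda>t. f"] C that by auto
qed

text \<open>Provides room around a compact set on two occasions: for a cutoff function to decay to
  zero inside the domain, and for the margin in the first exit argument.\<close>

lemma compact_infdist_neighborhood:
  fixes C X :: "'a::euclidean_space set"
  assumes "compact C" "C \<noteq> {}" "open X" "C \<subseteq> X"
  obtains \<delta> where "\<delta> > 0" "compact {z. infdist z C \<le> \<delta>}" "{z. infdist z C \<le> \<delta>} \<subseteq> X"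
proof -
  obtain e where "e > 0" and e: "{z. infdist z C \<le> e} \<subseteq> X"
    using compact_in_open_separated[OF assms(2,1,3,4)] by blast
  moreover have "compact {z. infdist z C \<le> e}"
    by (rule compact_infdist_le[OF assms(2,1)]) (use \<open>e > 0\<close> in simp)
  ultimately show thesis using that by blast
qed

text \<open>The extension is \<open>f\<close> multiplied by a Lipschitz cutoff function.\<close>

lemma locally_lipschitz_truncation:
  fixes f :: "'a::euclidean_space \<Rightarrow> 'b::euclidean_space"
  assumes f: "locally_lipschitz_on X f" and "open X" "compact C" "C \<subseteq> X" "C \<noteq> {}"
  obtains F \<Lambda> B where "\<Lambda>-lipschitz_on UNIV F" "0 \<le> B" "\<And>z. norm (F z) \<le> B" "\<And>z. z \<in> C \<Longrightarrow> F z = f z"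
proof -
  obtain \<delta> where "\<delta> > 0" and cC: "compact {z. infdist z C \<le> \<delta>}" and CX: "{z. infdist z C \<le> \<delta>} \<subseteq> X"
    using compact_infdist_neighborhood assms by metis
  define C' where "C' = {z. infdist z C \<le> \<delta>}"
  obtain M where M: "M-lipschitz_on C' f"
    using lipschitz_on_compact[OF f] cC CX unfolding C'_def by metis
  have "M \<ge> 0" using M lipschitz_on_nonneg by blast
  have "compact (f ` C')"
    using cC lipschitz_on_continuous_on[OF M] by (intro compact_continuous_image) (auto simp: C'_def)
  then have "bounded (f ` C')" by (rule compact_imp_bounded)
  then obtain B where "B > 0" and B: "\<And>z. z \<in> C' \<Longrightarrow> norm (f z) \<le> B"
    unfolding bounded_pos by auto
  \<comment> \<open>Equal to 1 on \<open>C\<close>, equal to 0 outside \<open>C'\<close>, and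
    Lipschitz with constant \<open>1 / \<delta>\<close>.\<close>
  define ct where "ct z = max 0 (1 - infdist z C / \<delta>)" for z
  define F where "F z = ct z *\<^sub>R f z" for z
  have chi: "0 \<le> ct z" "ct z \<le> 1" for z using \<open>\<delta> > 0\<close> by (auto simp: ct_def infdist_nonneg)
  have chi0: "ct z = 0" if "z \<notin> C'" for z using that \<open>\<delta> > 0\<close> by (auto simp: ct_def C'_def max_def field_simps)
  have chil: "\<bar>ct z - ct z'\<bar> \<le> dist z z' / \<delta>" for z z'
  proof -
    have "\<bar>ct z - ct z'\<bar> \<le> \<bar>infdist z C / \<delta> - infdist z' C / \<delta>\<bar>"
      by (auto simp: ct_def)
    also have "\<dots> = \<bar>infdist z C - infdist z' C\<bar> / \<delta>"
      using \<open>\<delta> > 0\<close> by (simp add: diff_divide_distrib[symmetric])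
    also have "\<dots> \<le> dist z z' / \<delta>"
      using \<open>\<delta> > 0\<close> infdist_triangle_abs[of z C z'] by (simp add: divide_right_mono)
    finally show ?thesis .
  qed
  \<comment> \<open>Inside \<open>C'\<close> this is the product rule: the increment of the cutoff
    meets the bound \<open>B\<close> on \<open>f\<close>, and the increment of \<open>f\<close>
    meets a cutoff value of at most 1. If \<open>z'\<close> is outside, where nothing is known about
    \<open>f z'\<close>, the cutoff vanishes at \<open>z'\<close> and only the first term survives.
    By symmetry it is enough that one of the two points lies in \<open>C'\<close>, since
    \<open>F\<close> is zero at both otherwise.\<close>
  have main: "norm (F z - F z') \<le> (B / \<delta> + M) * dist z z'" if "z \<in> C'" for z z'
  proof (cases "z' \<in> C'")
    case True
    have "F z - F z' = (ct z - ct z') *\<^sub>R f z + ct z' *\<^sub>R (f z - f z')"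
      by (simp add: F_def algebra_simps)
    then have "norm (F z - F z') \<le> \<bar>ct z - ct z'\<bar> * norm (f z) + ct z' * norm (f z - f z')"
      using norm_triangle_ineq[of "(ct z - ct z') *\<^sub>R f z" "ct z' *\<^sub>R (f z - f z')"] chi by simp
    also have "\<dots> \<le> dist z z' / \<delta> * B + 1 * (M * dist z z')"
      using chil chi B[OF that] \<open>\<delta> > 0\<close> \<open>B > 0\<close> \<open>M \<ge> 0\<close> lipschitz_onD[OF M that True]
      by (intro add_mono mult_mono) (auto simp: dist_norm)
    finally show ?thesis by (simp add: algebra_simps)
  next
    case False
    then have "norm (F z - F z') = \<bar>ct z - ct z'\<bar> * norm (f z)"
      using chi by (simp add: F_def chi0)
    also have "\<dots> \<le> dist z z' / \<delta> * B"
      using chil B[OF that] \<open>\<delta> > 0\<close> by (intro mult_mono) auto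
    also have "\<dots> \<le> (B / \<delta> + M) * dist z z'"
      using \<open>M \<ge> 0\<close> by (simp add: algebra_simps)
    finally show ?thesis .
  qed
  show thesis
  proof
    show "(B / \<delta> + M)-lipschitz_on UNIV F"
    proof (rule lipschitz_onI)
      show "0 \<le> B / \<delta> + M" using \<open>B > 0\<close> \<open>\<delta> > 0\<close> \<open>M \<ge> 0\<close> by simp
      fix z z'
      show "dist (F z) (F z') \<le> (B / \<delta> + M) * dist z z'"
        using main[of z z'] main[of z' z] \<open>0 \<le> B / \<delta> + M\<close>
        by (cases "z \<in> C'"; cases "z' \<in> C'") (auto simp: dist_norm norm_minus_commute F_def chi0)
    qed
    show "0 \<le> B" using \<open>B > 0\<close> by simp
    show "norm (F z) \<le> B" for z
    proof (cases "z \<in> C'")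
      case True
      then have "ct z * norm (f z) \<le> 1 * B" using chi B by (intro mult_mono) auto
      then show ?thesis using chi by (simp add: F_def)
    qed (use \<open>B > 0\<close> in \<open>simp add: F_def chi0\<close>)
    show "F z = f z" if "z \<in> C" for z
      using that by (simp add: F_def ct_def)
  qed
qed

subsection \<open>Dissipation of the weighted storage\<close>

lemma AE_lebesgue_on_negligible:
  assumes S: "S \<in> sets lebesgue"
  shows "(AE t in lebesgue_on S. P t) \<longleftrightarrow> (\<exists>N. negligible N \<and> (\<forall>t\<in>S - N. P t))"
proof
  assume "AE t in lebesgue_on S. P t"
  then have "AE t in lebesgue. t \<in> S \<longrightarrow> P t"
    using S by (subst (asm) AE_restrict_space_iff) auto
  then obtain N where "N \<in> null_sets lebesgue" "{t \<in> space lebesgue. \<not> (t \<in> S \<longrightarrow> P t)} \<subseteq> N"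
    unfolding eventually_ae_filter by blast
  then show "\<exists>N. negligible N \<and> (\<forall>t\<in>S - N. P t)"
    by (intro exI[of _ N]) (auto simp: negligible_iff_null_sets)
next
  assume "\<exists>N. negligible N \<and> (\<forall>t\<in>S - N. P t)"
  then obtain N where N: "N \<in> null_sets lebesgue" "\<forall>t\<in>S - N. P t"
    by (auto simp: negligible_iff_null_sets)
  then have "AE t in lebesgue. t \<in> S \<longrightarrow> P t"
    unfolding eventually_ae_filter by (intro bexI[of _ N]) auto
  then show "AE t in lebesgue_on S. P t"
    using S by (subst AE_restrict_space_iff) auto
qed

lemma bounded_measurable_absolutely_integrable:
  fixes f :: "real \<Rightarrow> 'a::euclidean_space"
  assumes "f \<in> borel_measurable (lebesgue_on {a..b})" "AE t in lebesgue_on {a..b}. norm (f t) \<le> B"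
  shows "f absolutely_integrable_on {a..b}"
proof -
  interpret finite_measure "lebesgue_on {a..b}"
    by (rule finite_measure_lebesgue_on) simp
  have "integrable (lebesgue_on {a..b}) f"
    by (rule integrable_const_bound[OF assms(2,1)])
  then show ?thesis
    unfolding set_integrable_def by (subst (asm) integrable_restrict_space) auto
qed

lemma measurable_compose_continuous_on_open:
  fixes f :: "'a::topological_space \<Rightarrow> 'b::real_normed_vector"
  assumes "open D" "continuous_on D f" "u \<in> borel_measurable M" "\<And>t. t \<in> space M \<Longrightarrow> u t \<in> D"
  shows "(\<lambda>t. f (u t)) \<in> borel_measurable M"
proof -
  have "(\<lambda>x. if x \<in> D then f x else 0) \<in> borel_measurable borel"
    using assms(1,2) by (intro borel_measurable_continuous_on_if) auto
  then have "(\<lambda>t. if u t \<in> D then f (u t) else 0) \<in> borel_measurable M"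
    using assms(3) measurable_compose by blast
  then show ?thesis
    using assms(4) by (subst measurable_cong[where g = "\<lambda>t. if u t \<in> D then f (u t) else 0"]) auto
qed

text \<open>Divided by \<open>a + b\<close>, both numbers lie in the unit interval, where a power
  with exponent \<open>q \<le> 1\<close> is at least its base, and the two quotients add up to 1.
  With \<open>q = 1 / p\<close> this separates the contributions of the input and of the initial
  state in the final estimate.\<close>

lemma powr_subadditive:
  fixes a b q :: real
  assumes "0 \<le> a" "0 \<le> b" "0 < q" "q \<le> 1"
  shows "(a + b) powr q \<le> a powr q + b powr q"
proof (cases "a + b = 0")
  case True
  with assms show ?thesis by simp
next
  case False
  define s where "s = a + b"
  have "s > 0" using False assms by (simp add: s_def)
  have le: "z / s \<le> (z / s) powr q" if "0 \<le> z" "z \<le> s" for z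
  proof -
    have "(z / s) powr 1 \<le> (z / s) powr q"
      using that \<open>s > 0\<close> assms by (intro powr_mono') auto
    then show ?thesis using that \<open>s > 0\<close> by simp
  qed
  have "1 = a / s + b / s" using \<open>s > 0\<close> by (simp add: s_def add_divide_distrib[symmetric])
  also have "\<dots> \<le> (a / s) powr q + (b / s) powr q"
    using assms by (intro add_mono le) (auto simp: s_def)
  also have "\<dots> = (a powr q + b powr q) / s powr q"
    using assms \<open>s > 0\<close> by (simp add: powr_divide add_divide_distrib)
  finally show ?thesis using \<open>s > 0\<close> by (simp add: s_def field_simps)
qed

lemma has_derivative_grad:
  fixes V :: "real ^ 'k \<Rightarrow> real"
  assumes "V differentiable (at x)"
  shows "(V has_derivative (\<lambda>v. grad V x \<bullet> v)) (at x)"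
proof -
  have V: "(V has_derivative frechet_derivative V (at x)) (at x)"
    using assms frechet_derivative_works by blast
  then interpret bounded_linear "frechet_derivative V (at x)"
    by (rule has_derivative_bounded_linear)
  have "frechet_derivative V (at x) v = grad V x \<bullet> v" for v
  proof -
    have "frechet_derivative V (at x) v = frechet_derivative V (at x) (\<Sum>i\<in>UNIV. v $ i *\<^sub>R axis i 1)"
      using basis_expansion[of v] by (simp add: scalar_mult_eq_scaleR)
    also have "\<dots> = (\<Sum>i\<in>UNIV. v $ i * frechet_derivative V (at x) (axis i 1))"
      by (simp add: sum scaleR)
    also have "\<dots> = grad V x \<bullet> v"
      by (simp add: inner_vec_def grad_def mult.commute)
    finally show ?thesis .
  qed
  then have "frechet_derivative V (at x) = (\<lambda>v. grad V x \<bullet> v)" by blast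
  with V show ?thesis by simp
qed

text \<open>The gradient is bounded on a closed ball inside \<open>D\<close>, and a ball is convex,
  so the mean value inequality applies. Lipschitz continuity on compact sets is what carries
  absolute continuity from \<open>x\<close> over to \<open>V\<close> along \<open>x\<close>.\<close>

lemma C1_on_imp_locally_lipschitz_on:
  assumes "open D" "C1_on D V"
  shows "locally_lipschitz_on D V"
  unfolding locally_lipschitz_on_def
proof
  fix x assume "x \<in> D"
  then obtain e where "e > 0" and e: "cball x e \<subseteq> D"
    using \<open>open D\<close> open_contains_cball by blast
  have "compact (grad V ` cball x e)"
    using assms(2) e by (intro compact_continuous_image) (auto simp: C1_on_def intro: continuous_on_subset)
  then have "bounded (grad V ` cball x e)" by (rule compact_imp_bounded)
  then obtain M where "M > 0" and M: "\<And>y. y \<in> cball x e \<Longrightarrow> norm (grad V y) \<le> M"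
    unfolding bounded_pos by auto
  have "M-lipschitz_on (cball x e) V"
  proof (rule lipschitz_onI)
    fix y z assume yz: "y \<in> cball x e" "z \<in> cball x e"
    have "norm (V y - V z) \<le> M * norm (y - z)"
    proof (rule differentiable_bound[OF convex_cball _ _ yz])
      fix w assume w: "w \<in> cball x e"
      then have "w \<in> D" using e by (rule set_mp[rotated])
      with assms(2) have "V differentiable (at w)"
        unfolding C1_on_def by simp
      then show "(V has_derivative (\<lambda>v. grad V w \<bullet> v)) (at w within cball x e)"
        by (rule has_derivative_at_withinI[OF has_derivative_grad])
      show "onorm ((\<bullet>) (grad V w)) \<le> M"
      proof (rule onorm_le)
        fix v
        have "norm (grad V w \<bullet> v) \<le> norm (grad V w) * norm v"
          by (simp add: Cauchy_Schwarz_ineq2)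
        also have "\<dots> \<le> M * norm v" using M[OF w] by (simp add: mult_right_mono)
        finally show "norm (grad V w \<bullet> v) \<le> M * norm v" .
      qed
    qed
    then show "dist (V y) (V z) \<le> M * dist y z" by (simp add: dist_norm)
  qed (use \<open>M > 0\<close> in simp)
  moreover have "cball x e \<inter> D = cball x e" using e by blast
  ultimately show "\<exists>e>0. \<exists>M. M-lipschitz_on (cball x e \<inter> D) V"
    using \<open>e > 0\<close> by (intro exI[of _ e] conjI exI[of _ M]) simp_all
qed

text \<open>Weighting the \<open>i\<close>-th subsystem by \<open>L ^ (i - 1)\<close> pairs the coupling term \<open>R i\<close> of a subsystem
  with \<open>L * G (i + 1)\<close> of its successor.\<close>

lemma weighted_coupling_sum_bound:
  fixes G R H :: "nat \<Rightarrow> real"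
  assumes "1 \<le> n" "0 \<le> L"
    and first: "G 1 \<le> A + b * H 1"
    and step: "\<And>i. \<lbrakk>1 \<le> i; i < n\<rbrakk> \<Longrightarrow> R i + L * G (i + 1) \<le> s * H i + b * L * H (i + 1)"
    and last: "R n \<le> s * H n"
  shows "(\<Sum>i=1..n. L ^ (i - 1) * (G i + R i)) \<le> A + (s + b) * (\<Sum>i=1..n. L ^ (i - 1) * H i)"
proof -
  \<comment> \<open>The partial sum withholds \<open>R m\<close>, which can be bounded only together
    with \<open>L * G (m + 1)\<close>, and the right-hand side withholds the matching share
    \<open>s * H m\<close>. Each induction step releases both; the bound on \<open>R n\<close>
    closes the last subsystem.\<close>
  have "m \<le> n \<Longrightarrow> (\<Sum>i=1..m. L ^ (i - 1) * (G i + R i)) - L ^ (m - 1) * R m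
      \<le> A + (s + b) * (\<Sum>i=1..m. L ^ (i - 1) * H i) - s * (L ^ (m - 1) * H m)" if "1 \<le> m" for m
    using that
  proof (induction m rule: dec_induct)
    case base
    then show ?case using first by (simp add: algebra_simps)
  next
    case (step m)
    have "L ^ (m - 1) * (R m + L * G (m + 1)) \<le> L ^ (m - 1) * (s * H m + b * L * H (m + 1))"
      using assms(2) step by (intro mult_left_mono assms(4)) auto
    moreover have "L ^ m = L ^ (m - 1) * L"
      using step(1) by (metis Suc_pred' less_eq_Suc_le One_nat_def power_Suc2)
    ultimately show ?case
      using step by (simp add: algebra_simps)
  qed
  from this[OF assms(1)] have "(\<Sum>i=1..n. L ^ (i - 1) * (G i + R i))
      \<le> A + (s + b) * (\<Sum>i=1..n. L ^ (i - 1) * H i) - s * (L ^ (n - 1) * H n) + L ^ (n - 1) * R n"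
    by simp
  moreover have "L ^ (n - 1) * R n \<le> L ^ (n - 1) * (s * H n)"
    using assms(2) last by (intro mult_left_mono) auto
  ultimately show ?thesis by (simp add: algebra_simps)
qed

lemma admissible_inputsD:
  assumes "u \<in> admissible_inputs A"
  shows "u \<in> borel_measurable (lebesgue_on {0..})" "\<And>t. 0 \<le> t \<Longrightarrow> u t \<in> A"
    "\<And>T. 0 < T \<Longrightarrow> \<exists>K. compact K \<and> K \<subseteq> A \<and> (AE t in lebesgue_on {0..T}. u t \<in> K)"
  using assms unfolding admissible_inputs_def by blast+

lemma admissible_input_measurable:
  assumes "u \<in> admissible_inputs A"
  shows "u \<in> borel_measurable (lebesgue_on {0..T})"
  by (rule measurable_restrict_mono[OF admissible_inputsD(1)[OF assms]]) simp

lemma admissible_input_compact: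
  assumes "u \<in> admissible_inputs A"
  obtains K N where "compact K" "K \<subseteq> A" "negligible N" "\<And>t. t \<in> {0..T} - N \<Longrightarrow> u t \<in> K"
proof -
  \<comment> \<open>The horizon \<open>\<bar>T\<bar> + 1\<close> is positive, as the definition of
    the input class demands, for every real \<open>T\<close>.\<close>
  obtain K where K: "compact K" "K \<subseteq> A" "AE t in lebesgue_on {0..\<bar>T\<bar>+1}. u t \<in> K"
    using admissible_inputsD(3)[OF assms, of "\<bar>T\<bar> + 1"] by (auto simp: add_nonneg_pos)
  obtain N where N: "negligible N" "\<forall>t\<in>{0..\<bar>T\<bar>+1} - N. u t \<in> K"
    using K(3) AE_lebesgue_on_negligible[of "{0..\<bar>T\<bar>+1}"] by auto
  have "{0..T} \<subseteq> {0..\<bar>T\<bar>+1}" by auto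
  with N K that[of K N] show thesis by blast
qed

section \<open>The string and its storage function\<close>

locale lyapunov_string =
  fixes D \<Omega> :: "(real ^ 'k) set"
    and f :: "(real ^ 'k) \<times> (real ^ 'k) \<times> (real ^ 'k) \<Rightarrow> real ^ 'k"
    and h :: "real ^ 'k \<Rightarrow> real ^ 'm"
    and V :: "real ^ 'k \<Rightarrow> real"
    and g r :: "(real ^ 'k) \<times> (real ^ 'k) \<Rightarrow> real"
    and p \<sigma> \<omega> \<Gamma>1 c L :: real
  assumes open_D: "open D" and zero_D: "0 \<in> D" and Omega_D: "\<Omega> \<subseteq> D"
    and cont_h: "continuous_on D h"
    and f_lip: "locally_lipschitz_on (D \<times> D \<times> D) f"
    and p_ge: "1 \<le> p"
    and C1_V: "C1_on D V" and V_nonneg: "\<And>x. x \<in> D \<Longrightarrow> 0 \<le> V x"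
    and Gamma1: "0 \<le> \<Gamma>1" and c_pos: "0 < c" and L_ge: "1 \<le> L"
    and dissipation: "\<And>x u w. \<lbrakk>x \<in> D; u \<in> D; w \<in> D\<rbrakk> \<Longrightarrow>
           grad V x \<bullet> f (u, x, w) \<le> - c * norm (h x) powr p + g (u, x) + r (x, w)"
    and g_input: "\<And>x u. \<lbrakk>x \<in> D; u \<in> \<Omega>\<rbrakk> \<Longrightarrow>
           g (u, x) \<le> \<Gamma>1 * norm (h u) powr p + c * \<omega> * norm (h x) powr p"
    and coupling: "\<And>x w. \<lbrakk>x \<in> D; w \<in> D\<rbrakk> \<Longrightarrow>
           r (x, w) + L * g (x, w) \<le> c * \<sigma> * norm (h x) powr p + c * \<omega> * L * norm (h w) powr p"
    and r_last: "\<And>x. x \<in> D \<Longrightarrow> r (x, 0) \<le> c * \<sigma> * norm (h x) powr p"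
    and small_gain: "\<sigma> + \<omega> < 1"
begin

text \<open>The net decay rate: of the dissipation \<open>c\<close>, the couplings consume the
  shares \<open>c * \<sigma>\<close> and \<open>c * \<omega>\<close>, and the small-gain condition
  leaves a positive remainder.\<close>

abbreviation "\<kappa> \<equiv> c * (1 - \<sigma> - \<omega>)"

lemma kappa_pos: "\<kappa> > 0"
  using c_pos small_gain by simp

definition storage :: "nat \<Rightarrow> (nat \<Rightarrow> real ^ 'k) \<Rightarrow> real" where
  "storage n z = (\<Sum>i=1..n. L ^ (i - 1) * V (z i))"

lemma storage_nonneg: "(\<And>i. i \<in> {1..n} \<Longrightarrow> z i \<in> D) \<Longrightarrow> 0 \<le> storage n z"
  unfolding storage_def using L_ge V_nonneg by (intro sum_nonneg mult_nonneg_nonneg) auto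

lemma L_power_ge: "1 \<le> L ^ i"
  using L_ge by (rule one_le_power)

text \<open>Since \<open>L \<ge> 1\<close>, all weights are at least 1, so a bound on the storage
  bounds every single \<open>V (z i)\<close> without loss of a factor depending on
  \<open>n\<close>.\<close>

lemma V_le_storage:
  assumes "\<And>i. i \<in> {1..n} \<Longrightarrow> z i \<in> D" "i \<in> {1..n}"
  shows "V (z i) \<le> storage n z"
proof -
  have "V (z i) \<le> L ^ (i - 1) * V (z i)"
    using mult_right_mono[OF L_power_ge V_nonneg[OF assms(1)[OF assms(2)]]] by simp
  also have "\<dots> \<le> storage n z"
    unfolding storage_def using assms L_ge V_nonneg by (intro member_le_sum) auto
  finally show ?thesis .
qed

text \<open>A pointwise inequality on the state space, with no trajectory involved. After inserting
  the boundary values \<open>u\<close> and 0 as neighbours, the coupling bounds fit together: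
  \<open>g_input\<close> handles the first link, \<open>coupling\<close> the interior ones, and
  \<open>r_last\<close> the link to the zero boundary value.\<close>

lemma storage_derivative_bound:
  assumes "1 \<le> n" and z: "\<And>i. i \<in> {1..n} \<Longrightarrow> z i \<in> D" and "u \<in> \<Omega>"
  shows "(\<Sum>i=1..n. L ^ (i - 1) * (grad V (z i) \<bullet> string_rhs f n u 0 z i))
    \<le> \<Gamma>1 * norm (h u) powr p - \<kappa> * (\<Sum>i=1..n. L ^ (i - 1) * norm (h (z i)) powr p)"
proof -
  define y where "y = with_boundary n u 0 z"
  have y: "y i \<in> D" if "i \<le> n + 1" for i
    using that z[of i] Omega_D zero_D \<open>u \<in> \<Omega>\<close> by (auto simp: y_def with_boundary_def)
  have yz: "y i = z i" if "i \<in> {1..n}" for i using that by (auto simp: y_def with_boundary_def)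
  have y0: "y 0 = u" and yn: "y (n + 1) = 0" by (auto simp: y_def with_boundary_def)
  define G where "G i = g (y (i - 1), y i)" for i
  define R where "R i = r (y i, y (i + 1))" for i
  define H where "H i = norm (h (y i)) powr p" for i
  have summand: "grad V (z i) \<bullet> string_rhs f n u 0 z i \<le> - c * H i + (G i + R i)" if "i \<in> {1..n}" for i
  proof -
    have "i \<le> n + 1" "i - 1 \<le> n + 1" "i + 1 \<le> n + 1" using that by auto
    then show ?thesis
      using dissipation[OF y[of i] y[of "i - 1"] y[of "i + 1"]] yz[OF that]
      by (simp add: string_rhs_def y_def[symmetric] G_def R_def H_def)
  qed
  have "(\<Sum>i=1..n. L ^ (i - 1) * (grad V (z i) \<bullet> string_rhs f n u 0 z i))
      \<le> (\<Sum>i=1..n. L ^ (i - 1) * (- c * H i + (G i + R i)))"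
    using L_ge summand by (intro sum_mono mult_left_mono) auto
  also have "\<dots> = - c * (\<Sum>i=1..n. L ^ (i - 1) * H i) + (\<Sum>i=1..n. L ^ (i - 1) * (G i + R i))"
    by (simp add: sum.distrib[symmetric] sum_distrib_left algebra_simps)
  also have "(\<Sum>i=1..n. L ^ (i - 1) * (G i + R i))
      \<le> \<Gamma>1 * norm (h u) powr p + (c * \<sigma> + c * \<omega>) * (\<Sum>i=1..n. L ^ (i - 1) * H i)"
  proof (rule weighted_coupling_sum_bound[OF \<open>1 \<le> n\<close>])
    show "0 \<le> L" using L_ge by simp
    show "G 1 \<le> \<Gamma>1 * norm (h u) powr p + c * \<omega> * H 1"
      using g_input[OF y[of 1] \<open>u \<in> \<Omega>\<close>] y0 by (simp add: G_def H_def)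
    show "R i + L * G (i + 1) \<le> c * \<sigma> * H i + c * \<omega> * L * H (i + 1)" if "1 \<le> i" "i < n" for i
      using coupling[OF y[of i] y[of "i + 1"]] that by (simp add: G_def R_def H_def)
    show "R n \<le> c * \<sigma> * H n"
      using r_last[OF y[of n]] yn by (simp add: R_def H_def)
  qed
  also have "(\<Sum>i=1..n. L ^ (i - 1) * H i) = (\<Sum>i=1..n. L ^ (i - 1) * norm (h (z i)) powr p)"
    by (intro sum.cong) (auto simp: H_def yz)
  finally show ?thesis by (simp add: algebra_simps)
qed

lemma output_power_measurable:
  assumes "u \<in> borel_measurable (lebesgue_on {0..T})" "\<And>t. t \<in> {0..T} \<Longrightarrow> u t \<in> D"
  shows "(\<lambda>t. norm (h (u t)) powr p) \<in> borel_measurable (lebesgue_on {0..T})"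
proof -
  have "(\<lambda>t. h (u t)) \<in> borel_measurable (lebesgue_on {0..T})"
    by (rule measurable_compose_continuous_on_open[OF open_D cont_h assms(1)]) (simp add: assms(2))
  then show ?thesis by measurable
qed

text \<open>Local essential boundedness of \<open>u\<close> alone would not suffice, since
  \<open>h\<close> may blow up at the boundary of \<open>D\<close>. The input stays almost
  everywhere in a compact subset of \<open>\<Omega>\<close>, on which the continuous
  \<open>h\<close> is bounded.\<close>

lemma input_power_integrable:
  assumes u: "u \<in> admissible_inputs \<Omega>" and "0 \<le> T"
  shows "(\<lambda>t. norm (h (u t)) powr p) absolutely_integrable_on {0..T}"
proof -
  note meas = admissible_input_measurable[OF u] admissible_inputsD(2)[OF u]
  obtain K N where K: "compact K" "K \<subseteq> \<Omega>" and N: "negligible N" "\<And>t. t \<in> {0..T} - N \<Longrightarrow> u t \<in> K"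
    using admissible_input_compact[OF u] by blast
  have "compact (h ` K)"
    using K Omega_D cont_h by (intro compact_continuous_image) (auto intro: continuous_on_subset)
  then have "bounded (h ` K)" by (rule compact_imp_bounded)
  then obtain B where B: "\<And>x. x \<in> K \<Longrightarrow> norm (h x) \<le> B"
    unfolding bounded_iff by blast
  have "AE t in lebesgue_on {0..T}. norm (norm (h (u t)) powr p) \<le> B powr p"
  proof (subst AE_lebesgue_on_negligible)
    show "\<exists>N. negligible N \<and> (\<forall>t\<in>{0..T} - N. norm (norm (h (u t)) powr p) \<le> B powr p)"
    proof (intro exI[of _ N] conjI ballI N(1))
      fix t assume "t \<in> {0..T} - N"
      then have "norm (h (u t)) \<le> B" using N(2) B by blast
      then show "norm (norm (h (u t)) powr p) \<le> B powr p" using p_ge by (simp add: powr_mono2)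
    qed
  qed simp
  moreover have "(\<lambda>t. norm (h (u t)) powr p) \<in> borel_measurable (lebesgue_on {0..T})"
    using meas Omega_D by (intro output_power_measurable) (simp_all, blast)
  ultimately show ?thesis
    by (intro bounded_measurable_absolutely_integrable)
qed

lemma output_power_integrable:
  fixes y :: "real \<Rightarrow> real ^ 'k"
  assumes "continuous_on {0..T} y" "\<And>t. t \<in> {0..T} \<Longrightarrow> y t \<in> D"
  shows "(\<lambda>t. norm (h (y t)) powr p) absolutely_integrable_on {0..T}"
proof (rule absolutely_integrable_continuous_real)
  have "continuous_on {0..T} (\<lambda>t. h (y t))"
    using assms by (intro continuous_on_compose2[OF cont_h]) auto
  then show "continuous_on {0..T} (\<lambda>t. norm (h (y t)) powr p)"
    using p_ge by (intro continuous_on_powr' continuous_intros) auto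
qed

lemma V_has_derivative: "x \<in> D \<Longrightarrow> (V has_derivative (\<lambda>v. grad V x \<bullet> v)) (at x)"
  using C1_V has_derivative_grad by (auto simp: C1_on_def)

text \<open>On a bounded time interval the components trace out a compact subset of
  \<open>D\<close>, on which \<open>V\<close> has one Lipschitz constant.\<close>

lemma abs_continuous_storage:
  assumes x: "\<And>i t. i \<in> {1..n} \<Longrightarrow> t \<in> {0..T} \<Longrightarrow> x t i \<in> D"
    and AC: "\<And>i. i \<in> {1..n} \<Longrightarrow> abs_continuous_on_interval 0 T (\<lambda>t. x t i)"
  shows "abs_continuous_on_interval 0 T (\<lambda>t. storage n (x t))"
proof -
  define C where "C = (\<Union>i\<in>{1..n}. (\<lambda>t. x t i) ` {0..T})"
  have "compact C"
    unfolding C_def using AC by (intro compact_UN compact_continuous_image abs_continuous_imp_continuous_on) auto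
  moreover have "C \<subseteq> D" using x by (auto simp: C_def)
  ultimately obtain M where M: "M-lipschitz_on C V"
    using lipschitz_on_compact[OF C1_on_imp_locally_lipschitz_on[OF open_D C1_V]] by metis
  have "M \<ge> 0" using M lipschitz_on_nonneg by blast
  show ?thesis
  proof (rule abs_continuous_sum_bound[OF finite_atLeastAtMost AC])
    show "0 \<le> L ^ (i - 1) * M" for i using \<open>M \<ge> 0\<close> L_ge by simp
    fix s t assume st: "s \<in> {0..T}" "t \<in> {0..T}"
    have "norm (storage n (x s) - storage n (x t)) = norm (\<Sum>i=1..n. L ^ (i - 1) * (V (x s i) - V (x t i)))"
      by (simp add: storage_def sum_subtractf right_diff_distrib)
    also have "\<dots> \<le> (\<Sum>i=1..n. L ^ (i - 1) * M * norm (x s i - x t i))"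
    proof (rule sum_norm_le)
      fix i assume i: "i \<in> {1..n}"
      have "\<bar>V (x s i) - V (x t i)\<bar> \<le> M * norm (x s i - x t i)"
      proof -
        have "x s i \<in> C" "x t i \<in> C" using i st unfolding C_def by blast+
        from lipschitz_onD[OF M this] show ?thesis by (simp add: dist_norm)
      qed
      then have "L ^ (i - 1) * \<bar>V (x s i) - V (x t i)\<bar> \<le> L ^ (i - 1) * (M * norm (x s i - x t i))"
        using L_ge by (intro mult_left_mono) auto
      then show "norm (L ^ (i - 1) * (V (x s i) - V (x t i))) \<le> L ^ (i - 1) * M * norm (x s i - x t i)"
        using L_ge by (simp add: abs_mult mult.assoc)
    qed
    finally show "norm (storage n (x s) - storage n (x t)) \<le> (\<Sum>i=1..n. L ^ (i - 1) * M * norm (x s i - x t i))" .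
  qed
qed

text \<open>Used twice with opposite emphasis: for the stability estimate the output integrals on
  the left matter, for the existence proof they are dropped and the storage itself is bounded a
  priori. Derivatives are taken within \<open>{0..T}\<close>, so that a solution known only on a
  bounded interval is covered too.\<close>

lemma storage_dissipation:
  assumes "1 \<le> n" "0 \<le> T" and u: "u \<in> admissible_inputs \<Omega>"
    and x: "\<And>i t. i \<in> {1..n} \<Longrightarrow> t \<in> {0..T} \<Longrightarrow> x t i \<in> D"
    and AC: "\<And>i. i \<in> {1..n} \<Longrightarrow> abs_continuous_on_interval 0 T (\<lambda>t. x t i)"
    and N: "negligible N"
    and deriv: "\<And>i t. i \<in> {1..n} \<Longrightarrow> t \<in> {0..T} - N \<Longrightarrow>
      ((\<lambda>s. x s i) has_vector_derivative string_rhs f n (u t) 0 (x t) i) (at t within {0..T})"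
  shows "storage n (x T) + \<kappa> * (\<Sum>i=1..n. L ^ (i - 1) * integral {0..T} (\<lambda>s. norm (h (x s i)) powr p))
    \<le> storage n (x 0) + \<Gamma>1 * integral {0..T} (\<lambda>s. norm (h (u s)) powr p)"
proof -
  define w where "w t = (\<Sum>i=1..n. L ^ (i - 1) * (grad V (x t i) \<bullet> string_rhs f n (u t) 0 (x t) i))" for t
  define \<psi> where "\<psi> t = \<Gamma>1 * norm (h (u t)) powr p - \<kappa> * (\<Sum>i=1..n. L ^ (i - 1) * norm (h (x t i)) powr p)" for t
  have der: "((\<lambda>s. storage n (x s)) has_vector_derivative w t) (at t within {0..T})" if t: "t \<in> {0..T} - N" for t
  proof -
    have "((\<lambda>s. V (x s i)) has_vector_derivative grad V (x t i) \<bullet> string_rhs f n (u t) 0 (x t) i) (at t within {0..T})"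
      if i: "i \<in> {1..n}" for i
      using vector_derivative_diff_chain_within[OF deriv[OF i t] has_derivative_at_withinI[OF V_has_derivative[OF x[of i t]]]] i t
      by (auto simp: o_def)
    then show ?thesis
      unfolding storage_def w_def
      by (intro has_vector_derivative_sum has_vector_derivative_mult_right) auto
  qed
  have wint: "(w has_integral storage n (x T) - storage n (x 0)) {0..T}"
    by (rule has_integral_abs_continuous[OF \<open>0 \<le> T\<close> abs_continuous_storage[OF x AC] N der])
  have cont: "continuous_on {0..T} (\<lambda>t. x t i)" if "i \<in> {1..n}" for i
    using AC[OF that] by (rule abs_continuous_imp_continuous_on)
  have hint: "(\<lambda>s. norm (h (x s i)) powr p) integrable_on {0..T}" if "i \<in> {1..n}" for i
    using output_power_integrable[OF cont[OF that] x[OF that]] by (rule set_lebesgue_integral_eq_integral(1))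
  have uint: "(\<lambda>s. norm (h (u s)) powr p) integrable_on {0..T}"
    using input_power_integrable[OF u \<open>0 \<le> T\<close>] by (rule set_lebesgue_integral_eq_integral(1))
  have psi: "(\<psi> has_integral \<Gamma>1 * integral {0..T} (\<lambda>s. norm (h (u s)) powr p)
      - \<kappa> * (\<Sum>i=1..n. L ^ (i - 1) * integral {0..T} (\<lambda>s. norm (h (x s i)) powr p))) {0..T}"
    unfolding \<psi>_def
    by (intro has_integral_diff has_integral_mult_right has_integral_sum integrable_integral uint hint) auto
  \<comment> \<open>This holds at every \<open>t\<close>, also on \<open>N\<close>, because
    \<open>w\<close> is defined through the right-hand side of the system and not as a
    derivative.\<close>
  have wpsi: "w t \<le> \<psi> t" if "t \<in> {0..T}" for t
    unfolding w_def \<psi>_def using that x u \<open>1 \<le> n\<close>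
    by (intro storage_derivative_bound) (auto simp: admissible_inputs_def)
  have "storage n (x T) - storage n (x 0) \<le> \<Gamma>1 * integral {0..T} (\<lambda>s. norm (h (u s)) powr p)
      - \<kappa> * (\<Sum>i=1..n. L ^ (i - 1) * integral {0..T} (\<lambda>s. norm (h (x s i)) powr p))"
    by (rule has_integral_le[OF wint psi wpsi])
  then show ?thesis by simp
qed

end

lemma solution_derivatives:
  assumes "is_solution D f n \<xi> u w x"
  obtains N where "negligible N"
    "\<And>i t. \<lbrakk>i \<in> {1..n}; t \<in> {0..} - N\<rbrakk> \<Longrightarrow>
      ((\<lambda>s. x s i) has_vector_derivative string_rhs f n (u t) (w t) (x t) i) (at t)"
proof -
  have "\<forall>i\<in>{1..n}. \<exists>N. negligible N \<and> (\<forall>t\<in>{0..} - N.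
      ((\<lambda>s. x s i) has_vector_derivative string_rhs f n (u t) (w t) (x t) i) (at t))"
    using assms unfolding is_solution_def by (simp add: AE_lebesgue_on_negligible)
  from bchoice[OF this] obtain N where N: "\<forall>i\<in>{1..n}. negligible (N i) \<and> (\<forall>t\<in>{0..} - N i.
      ((\<lambda>s. x s i) has_vector_derivative string_rhs f n (u t) (w t) (x t) i) (at t))"
    by blast
  show thesis
  proof (rule that[of "\<Union>i\<in>{1..n}. N i"])
    show "negligible (\<Union>i\<in>{1..n}. N i)"
      using N by (intro negligible_Union) auto
  qed (use N in blast)
qed

text \<open>A continuity argument: \<open>step\<close> improves "within \<open>\<delta>\<close> of
  \<open>K\<close>" to "in \<open>K\<close>", so the distance can never take a value strictly
  between 0 and \<open>\<delta>\<close>. Summing the distances over all components lets a single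
  real function record the first exit of any of them.\<close>

lemma first_exit_continuation:
  fixes x :: "real \<Rightarrow> 'i \<Rightarrow> 'a::metric_space"
  assumes "finite I" and cont: "\<And>i. i \<in> I \<Longrightarrow> continuous_on {0..T} (\<lambda>t. x t i)"
    and "closed K" "K \<noteq> {}" "0 < \<delta>" and start: "\<And>i. i \<in> I \<Longrightarrow> x 0 i \<in> K"
    and step: "\<And>\<tau> i. \<lbrakk>\<tau> \<in> {0..T}; \<And>s j. \<lbrakk>s \<in> {0..\<tau>}; j \<in> I\<rbrakk> \<Longrightarrow> infdist (x s j) K \<le> \<delta>; i \<in> I\<rbrakk> \<Longrightarrow> x \<tau> i \<in> K"
    and t: "t \<in> {0..T}" and i: "i \<in> I"
  shows "x t i \<in> K"
proof -
  define d where "d t = (\<Sum>i\<in>I. infdist (x t i) K)" for t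
  have d_cont: "continuous_on {0..T} d"
    unfolding d_def by (intro continuous_intros cont)
  have d_le: "infdist (x s j) K \<le> d s" if "j \<in> I" for s j
    unfolding d_def using that \<open>finite I\<close> by (intro member_le_sum) (auto simp: infdist_nonneg)
  have stay: "x \<tau> j \<in> K" if "\<tau> \<in> {0..T}" "\<And>s. s \<in> {0..\<tau>} \<Longrightarrow> d s \<le> \<delta>" "j \<in> I" for \<tau> j
    using step[OF that(1) _ that(3)] d_le that(2) by (meson order_trans)
  have "d s < \<delta>" if "s \<in> {0..T}" for s
  proof (rule ccontr)
    assume "\<not> d s < \<delta>"
    define A where "A = {s \<in> {0..T}. \<delta> \<le> d s}"
    have "A = {0..T} \<inter> d -` {\<delta>..}" by (auto simp: A_def)
    moreover have "closed ({0..T} \<inter> d -` {\<delta>..})"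
      by (rule continuous_closed_preimage[OF d_cont]) auto
    moreover have "bounded A"
      by (rule bounded_subset[of "{0..T}"]) (auto simp: A_def)
    ultimately have "compact A"
      by (simp only: compact_eq_bounded_closed simp_thms)
    moreover have "A \<noteq> {}" using that \<open>\<not> d s < \<delta>\<close> by (auto simp: A_def)
    ultimately obtain m where m: "m \<in> A" "\<And>s. s \<in> A \<Longrightarrow> m \<le> s"
      using compact_attains_inf[of A] by meson
    have "d 0 = 0" using start by (simp add: d_def)
    moreover have "continuous_on {0..m} d"
      using d_cont m(1) by (rule_tac continuous_on_subset) (auto simp: A_def)
    \<comment> \<open>Before the first time \<open>m\<close> at which the distance reaches
      \<open>\<delta>\<close>, it must pass through \<open>\<delta> / 2\<close>. Up to that earlier
      time \<open>s\<close> the margin is respected, so \<open>step\<close> forces the distance at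
      \<open>s\<close> to be 0, a contradiction.\<close>
    ultimately obtain s where s: "0 \<le> s" "s \<le> m" "d s = \<delta> / 2"
      using IVT'[of d 0 "\<delta> / 2" m] m(1) \<open>0 < \<delta>\<close> by (auto simp: A_def)
    have "s \<noteq> m" using s(3) m(1) \<open>0 < \<delta>\<close> by (auto simp: A_def)
    have "d \<tau> \<le> \<delta>" if "\<tau> \<in> {0..s}" for \<tau>
      using that m s \<open>s \<noteq> m\<close> by (force simp: A_def)
    then have "x s j \<in> K" if "j \<in> I" for j
      using stay[of s j] that s m(1) by (auto simp: A_def)
    then have "d s = 0" by (simp add: d_def)
    then show False using s(3) \<open>0 < \<delta>\<close> by simp
  qed
  then show ?thesis
    using stay[OF t _ i] t by (meson atLeastAtMost_iff less_imp_le order_trans)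
qed

section \<open>The string stability estimate\<close>

context lyapunov_string
begin

text \<open>From the integrated dissipation inequality the final storage is dropped as nonnegative,
  and of the weighted sum only the \<open>i\<close>-th term is kept, its weight being at least 1.
  Dividing by \<open>\<kappa>\<close> and taking the \<open>p\<close>-th root, which is subadditive,
  yields the stated gain and offset.\<close>

lemma string_estimate_storage:
  assumes "1 \<le> n"
  shows "string_estimate D \<Omega> {0} f h p (\<lambda>s. (\<Gamma>1 / \<kappa>) powr (1 / p) * s) (\<lambda>s. 0)
    (\<lambda>\<xi>. (1 / \<kappa> * (\<Sum>i=1..n. L ^ (i - 1) * V (\<xi> i))) powr (1 / p)) n"
  unfolding string_estimate_def
proof (intro ballI allI impI)
  fix \<xi> u w x t i
  assume \<xi>: "\<xi> \<in> states D n" and u: "u \<in> admissible_inputs \<Omega>" and w: "w \<in> admissible_inputs {0}"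
    and sol: "is_solution D f n \<xi> u w x" and t: "0 \<le> (t::real)" and i: "i \<in> {1..n}"
  have xD: "x s j \<in> D" if "0 \<le> s" "j \<in> {1..n}" for s j
    using sol that by (auto simp: is_solution_def states_def PiE_iff)
  have AC: "abs_continuous_on_interval 0 t (\<lambda>s. x s j)" if "j \<in> {1..n}" for j
  proof (rule abs_continuous_on_interval_subset)
    \<comment> \<open>A solution is absolutely continuous on intervals of positive length by
      definition; the longer interval also serves \<open>t = 0\<close>.\<close>
    show "abs_continuous_on_interval 0 (t + 1) (\<lambda>s. x s j)"
      using sol that t by (simp add: is_solution_def)
  qed auto
  obtain N where N: "negligible N" "\<And>j s. \<lbrakk>j \<in> {1..n}; s \<in> {0..} - N\<rbrakk> \<Longrightarrow>
      ((\<lambda>s. x s j) has_vector_derivative string_rhs f n (u s) (w s) (x s) j) (at s)"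
    using solution_derivatives[OF sol] by blast
  define I where "I j = integral {0..t} (\<lambda>s. norm (h (x s j)) powr p)" for j
  define U where "U = integral {0..t} (\<lambda>s. norm (h (u s)) powr p)"
  have diss: "storage n (x t) + \<kappa> * (\<Sum>j=1..n. L ^ (j - 1) * I j) \<le> storage n (x 0) + \<Gamma>1 * U"
    unfolding I_def U_def
  proof (rule storage_dissipation[OF \<open>1 \<le> n\<close> t u _ AC N(1)])
    fix j s assume "j \<in> {1..n}" "s \<in> {0..t} - N"
    then show "((\<lambda>s. x s j) has_vector_derivative string_rhs f n (u s) 0 (x s) j) (at s within {0..t})"
      using N(2)[of j s] admissible_inputsD(2)[OF w, of s] by (auto intro: has_vector_derivative_at_within)
  qed (use xD in auto)
  have out: "(\<lambda>s. norm (h (x s j)) powr p) absolutely_integrable_on {0..t}" if "j \<in> {1..n}" for j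
    using xD that by (intro output_power_integrable abs_continuous_imp_continuous_on AC) auto
  have inp: "(\<lambda>s. norm (h (u s)) powr p) absolutely_integrable_on {0..t}"
    by (rule input_power_integrable[OF u t])
  have I_nonneg: "0 \<le> I j" if "j \<in> {1..n}" for j
    unfolding I_def by (rule integral_nonneg[OF set_lebesgue_integral_eq_integral(1)[OF out[OF that]]]) simp
  have U_nonneg: "0 \<le> U"
    unfolding U_def by (rule integral_nonneg[OF set_lebesgue_integral_eq_integral(1)[OF inp]]) simp
  have norms: "Lp_norm p t (\<lambda>s. h (x s i)) = I i powr (1 / p)" "Lp_norm p t (\<lambda>s. h (u s)) = U powr (1 / p)"
    unfolding Lp_norm_def I_def U_def using set_lebesgue_integral_eq_integral(2)[OF out[OF i]]
      set_lebesgue_integral_eq_integral(2)[OF inp] by simp_all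
  have x0: "storage n (x 0) = storage n \<xi>"
    using sol by (simp add: is_solution_def)
  have xi: "0 \<le> storage n \<xi>"
    using \<xi> by (intro storage_nonneg) (auto simp: states_def)
  have "I i \<le> L ^ (i - 1) * I i"
    using mult_right_mono[OF L_power_ge I_nonneg[OF i]] by simp
  also have "\<dots> \<le> (\<Sum>j=1..n. L ^ (j - 1) * I j)"
    using i L_ge I_nonneg by (intro member_le_sum) auto
  finally have "\<kappa> * I i \<le> \<kappa> * (\<Sum>j=1..n. L ^ (j - 1) * I j)"
    using kappa_pos by (intro mult_left_mono) auto
  also have "\<dots> \<le> storage n \<xi> + \<Gamma>1 * U"
    using diss storage_nonneg[of n "x t"] xD t by (simp add: x0)
  finally have "I i \<le> (storage n \<xi> + \<Gamma>1 * U) / \<kappa>"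
    using kappa_pos by (simp only: pos_le_divide_eq mult.commute)
  then have "I i \<le> \<Gamma>1 / \<kappa> * U + 1 / \<kappa> * storage n \<xi>"
    by (simp add: add_divide_distrib)
  then have "I i powr (1 / p) \<le> (\<Gamma>1 / \<kappa> * U + 1 / \<kappa> * storage n \<xi>) powr (1 / p)"
    using I_nonneg[OF i] p_ge by (intro powr_mono2) auto
  also have "\<dots> \<le> (\<Gamma>1 / \<kappa> * U) powr (1 / p) + (1 / \<kappa> * storage n \<xi>) powr (1 / p)"
    using kappa_pos Gamma1 U_nonneg xi p_ge by (intro powr_subadditive) auto
  also have "(\<Gamma>1 / \<kappa> * U) powr (1 / p) = (\<Gamma>1 / \<kappa>) powr (1 / p) * U powr (1 / p)"
    by (rule powr_mult)
  finally show "Lp_norm p t (\<lambda>s. h (x s i)) \<le> (\<Gamma>1 / \<kappa>) powr (1 / p) * Lp_norm p t (\<lambda>s. h (u s)) + 0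
      + (1 / \<kappa> * (\<Sum>i=1..n. L ^ (i - 1) * V (\<xi> i))) powr (1 / p)"
    by (simp only: norms storage_def add_0_right)
qed

lemma Lp_string_stableI:
  assumes "\<And>n. 1 \<le> n \<Longrightarrow> forward_complete D \<Omega> {0} f n"
  shows "Lp_string_stable D \<Omega> {0} f h p"
  unfolding Lp_string_stable_def
proof (intro exI conjI allI impI)
  let ?q = "(\<Gamma>1 / \<kappa>) powr (1 / p)"
  show "continuous_on {0..} (\<lambda>s. ?q * s)" by (intro continuous_intros)
  show "mono_on {0..} (\<lambda>s. ?q * s)" by (intro mono_onI mult_left_mono) auto
  show "0 \<le> ?q * s" if "0 \<le> s" for s using that by simp
  show "continuous_on {0..} (\<lambda>s::real. 0::real)" by (intro continuous_intros)
  show "mono_on {0..} (\<lambda>s::real. 0::real)" by (intro mono_onI) auto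
  fix n :: nat assume n: "1 \<le> n"
  show "forward_complete D \<Omega> {0} f n" by (rule assms[OF n])
  show "string_estimate D \<Omega> {0} f h p (\<lambda>s. ?q * s) (\<lambda>s. 0)
    (\<lambda>\<xi>. (1 / \<kappa> * (\<Sum>i=1..n. L ^ (i - 1) * V (\<xi> i))) powr (1 / p)) n"
    by (rule string_estimate_storage[OF n])
  show "continuous_on (states D n) (\<lambda>\<xi>. (1 / \<kappa> * (\<Sum>i=1..n. L ^ (i - 1) * V (\<xi> i))) powr (1 / p))"
  proof (rule continuous_on_powr')
    have "continuous_on D V"
      using V_has_derivative has_derivative_continuous continuous_at_imp_continuous_on by blast
    then have "continuous_on (states D n) (\<lambda>\<xi>. V (\<xi> i))" if "i \<in> {1..n}" for i
    proof (rule continuous_on_compose2)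
      show "continuous_on (states D n) (\<lambda>\<xi>. \<xi> i)"
        by (rule continuous_on_subset[OF continuous_on_product_coordinates]) simp
    qed (use that in \<open>auto simp: states_def\<close>)
    then show "continuous_on (states D n) (\<lambda>\<xi>. 1 / \<kappa> * (\<Sum>i=1..n. L ^ (i - 1) * V (\<xi> i)))"
      by (intro continuous_intros)
    have "0 \<le> 1 / \<kappa> * storage n \<xi>" if "\<xi> \<in> states D n" for \<xi>
      using that kappa_pos by (intro mult_nonneg_nonneg storage_nonneg) (auto simp: states_def)
    \<comment> \<open>At states of zero storage, continuity of the root rests on the exponent
      \<open>1 / p\<close> being positive.\<close>
    then show "\<forall>\<xi>\<in>states D n. 0 \<le> 1 / \<kappa> * (\<Sum>i=1..n. L ^ (i - 1) * V (\<xi> i)) \<and>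
        (1 / \<kappa> * (\<Sum>i=1..n. L ^ (i - 1) * V (\<xi> i)) = 0 \<longrightarrow> 0 < 1 / p)"
      using p_ge by (auto simp: storage_def)
  qed (intro continuous_intros)
qed auto

end

subsection \<open>Global existence\<close>

lemma string_rhs_cong:
  assumes "\<And>j. j \<in> {1..n} \<Longrightarrow> z j = z' j" "i \<in> {1..n}"
  shows "string_rhs F n u w z i = string_rhs F n u w z' i"
proof -
  have "with_boundary n u w z j = with_boundary n u w z' j" if "j \<le> n + 1" for j
    using that assms(1)[of j] by (auto simp: with_boundary_def)
  then show ?thesis using assms(2) unfolding string_rhs_def by (intro arg_cong[where f = F]) auto
qed

text \<open>Only the left neighbour can be the input, and the right boundary value shares the set
  \<open>X\<close> with the states. Hence sets of the shape
  \<open>(U \<union> X) \<times> X \<times> X\<close> contain all arguments of \<open>f\<close>, for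
  every position in the string.\<close>

lemma with_boundary_triple_mem:
  assumes "u \<in> U" "w \<in> X" "\<And>j. j \<in> {1..n} \<Longrightarrow> z j \<in> X" "i \<in> {1..n}"
  shows "with_boundary n u w z (i - 1) \<in> U \<union> X" "with_boundary n u w z i \<in> X" "with_boundary n u w z (i + 1) \<in> X"
proof -
  have "j \<in> {1..n} \<Longrightarrow> with_boundary n u w z j \<in> X" for j
    using assms(3)[of j] by (simp add: with_boundary_def)
  moreover have "i - 1 = 0 \<or> i - 1 \<in> {1..n}" "i + 1 = n + 1 \<or> i + 1 \<in> {1..n}"
    using assms(4) by auto
  moreover have "with_boundary n u w z 0 = u" "with_boundary n u w z (n + 1) = w"
    by (simp_all add: with_boundary_def)
  ultimately show "with_boundary n u w z (i - 1) \<in> U \<union> X" "with_boundary n u w z i \<in> X"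
    "with_boundary n u w z (i + 1) \<in> X"
    using assms(1,2,4) by (metis UnI1 UnI2)+
qed

lemma string_rhs_lipschitz:
  assumes F: "\<Lambda>-lipschitz_on UNIV F" and i: "i \<in> {1..n}"
    and e: "\<And>j. j \<in> {1..n} \<Longrightarrow> norm (z j - z' j) \<le> e"
  shows "norm (string_rhs F n u w z i - string_rhs F n u w z' i) \<le> (3 * \<Lambda>) * e"
proof -
  let ?b = "with_boundary n u w"
  have "0 \<le> e" using e[OF i] norm_ge_zero order_trans by blast
  then have b: "norm (?b z j - ?b z' j) \<le> e" if "j \<le> n + 1" for j
    using that e[of j] by (auto simp: with_boundary_def)
  have "norm (string_rhs F n u w z i - string_rhs F n u w z' i)
      \<le> \<Lambda> * norm (?b z (i - 1) - ?b z' (i - 1), ?b z i - ?b z' i, ?b z (i + 1) - ?b z' (i + 1))"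
    unfolding string_rhs_def using lipschitz_on_normD[OF F UNIV_I UNIV_I] by (metis (no_types, lifting) diff_Pair)
  \<comment> \<open>The norm of a triple is at most the sum of the norms of its entries, each at
    most \<open>e\<close>; this is the origin of the factor 3.\<close>
  also have "norm (?b z (i - 1) - ?b z' (i - 1), ?b z i - ?b z' i, ?b z (i + 1) - ?b z' (i + 1)) \<le> e + (e + e)"
    using i by (intro order_trans[OF norm_Pair_le] add_mono b) auto
  finally have "norm (string_rhs F n u w z i - string_rhs F n u w z' i) \<le> \<Lambda> * (e + (e + e))"
    using lipschitz_on_nonneg[OF F] by (simp only: mult_left_mono)
  then show ?thesis by (simp add: algebra_simps)
qed

lemma string_rhs_integrable:
  fixes T :: real
  assumes F: "continuous_on UNIV F" "\<And>z. norm (F z) \<le> B" and i: "i \<in> {1..n}"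
    and u: "u \<in> borel_measurable (lebesgue_on {0..T})"
    and y: "\<And>j. j \<in> {1..n} \<Longrightarrow> continuous_on {0..T} (\<lambda>t. y t j)"
  shows "(\<lambda>t. string_rhs F n (u t) w (y t) i) integrable_on {0..T}"
proof -
  have b: "(\<lambda>t. with_boundary n (u t) w (y t) j) \<in> borel_measurable (lebesgue_on {0..T})" if "j \<le> n + 1" for j
  proof -
    consider "j = 0" | "j = n + 1" | "j \<in> {1..n}" using \<open>j \<le> n + 1\<close> by force
    then show ?thesis
    proof cases
      case 3
      then have "(\<lambda>t. y t j) \<in> borel_measurable (lebesgue_on {0..T})"
        by (intro continuous_imp_measurable_on_sets_lebesgue y) auto
      with 3 show ?thesis by (simp add: with_boundary_def)
    qed (use u in \<open>simp_all add: with_boundary_def\<close>)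
  qed
  have "(\<lambda>t. string_rhs F n (u t) w (y t) i) \<in> borel_measurable (lebesgue_on {0..T})"
    unfolding string_rhs_def using i
    by (intro measurable_compose[OF _ borel_measurable_continuous_onI[OF F(1)]] borel_measurable_Pair b) auto
  then have "(\<lambda>t. string_rhs F n (u t) w (y t) i) absolutely_integrable_on {0..T}"
    using F(2) by (intro bounded_measurable_absolutely_integrable[of _ _ _ B]) (auto simp: string_rhs_def)
  then show ?thesis by (rule set_lebesgue_integral_eq_integral(1))
qed

lemma has_integral_between:
  fixes G x :: "real \<Rightarrow> 'a::euclidean_space"
  assumes "\<And>t. t \<in> {0..T} \<Longrightarrow> (G has_integral x t - x 0) {0..t}" "0 \<le> a" "a \<le> b" "b \<le> T"
  shows "(G has_integral x b - x a) {a..b}"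
proof -
  have a: "(G has_integral x a - x 0) {0..a}" and b: "(G has_integral x b - x 0) {0..b}"
    using assms by auto
  have "G integrable_on {a..b}"
    using assms by (intro integrable_on_subinterval[OF has_integral_integrable[OF b]]) auto
  moreover have "integral {0..a} G + integral {a..b} G = integral {0..b} G"
    using assms by (intro Henstock_Kurzweil_Integration.integral_combine has_integral_integrable[OF b]) auto
  ultimately show ?thesis
    using integral_unique[OF a] integral_unique[OF b] by (simp add: has_integral_iff algebra_simps)
qed

lemma bounded_integrand_lipschitz:
  fixes G x :: "real \<Rightarrow> 'a::euclidean_space"
  assumes int: "\<And>a b. \<lbrakk>0 \<le> a; a \<le> b; b \<le> T\<rbrakk> \<Longrightarrow> (G has_integral x b - x a) {a..b}"
    and G: "\<And>t. norm (G t) \<le> B"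
  shows "B-lipschitz_on {0..T} x"
proof (rule lipschitz_on_leI)
  show "0 \<le> B" using G[of 0] norm_ge_zero order_trans by blast
  fix s t assume "s \<in> {0..T}" "t \<in> {0..T}" "s \<le> t"
  then have "norm (x t - x s) \<le> B * measure lborel {s..t}"
    using \<open>0 \<le> B\<close> G by (intro has_integral_bound_real[OF _ finite.emptyI int]) auto
  then show "dist (x s) (x t) \<le> B * dist s t"
    using \<open>s \<le> t\<close> by (simp add: dist_norm norm_minus_commute)
qed

text \<open>Boundedness of \<open>f\<close> is stated on one set that fits every subsystem: the left
  argument is an input or a state, and the right boundary value 0 belongs to the sublevel set as
  soon as \<open>\<rho> \<ge> V 0\<close>.\<close>

locale proper_lyapunov_string = lyapunov_string D \<Omega> f h V g r p \<sigma> \<omega> \<Gamma>1 c L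
  for D \<Omega> :: "(real ^ 'k) set" and f and h :: "real ^ 'k \<Rightarrow> real ^ 'm" and V g r p \<sigma> \<omega> \<Gamma>1 c L +
  assumes sublevel_compact: "\<And>\<rho>. 0 < \<rho> \<Longrightarrow> compact {\<xi>\<in>D. V \<xi> \<le> \<rho> \<and> norm \<xi> \<le> \<rho>}"
    and f_bounded: "\<And>K \<rho>. \<lbrakk>compact K; K \<subseteq> \<Omega>; 0 < \<rho>\<rbrakk> \<Longrightarrow>
      bounded (f ` ((K \<union> {\<xi>\<in>D. V \<xi> \<le> \<rho>}) \<times> {\<xi>\<in>D. V \<xi> \<le> \<rho>} \<times> {\<xi>\<in>D. V \<xi> \<le> \<rho>}))"
begin

text \<open>The truncated system is solved on the unit interval. As long as its solution stays near the compact
  set \<open>K\<close> it solves the original system, and the dissipation estimate then puts it back into \<open>K\<close>.\<close>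

lemma unit_interval_solution:
  assumes "1 \<le> n" and \<xi>: "\<xi> \<in> states D n" and u: "u \<in> admissible_inputs \<Omega>"
  obtains x B where "x 0 = \<xi>" "\<And>t. t \<in> {0..1} \<Longrightarrow> x t \<in> states D n"
    "\<And>i t. \<lbrakk>i \<in> {1..n}; t \<in> {0..1}\<rbrakk> \<Longrightarrow>
      ((\<lambda>s. string_rhs f n (u s) 0 (x s) i) has_integral x t i - \<xi> i) {0..t}"
    "\<And>i. i \<in> {1..n} \<Longrightarrow> B-lipschitz_on {0..1} (\<lambda>t. x t i)"
proof -
  have xi: "\<xi> i \<in> D" if "i \<in> {1..n}" for i using \<xi> that by (auto simp: states_def)
  obtain Ku N where Ku: "compact Ku" "Ku \<subseteq> \<Omega>" and N: "negligible N" "\<And>t. t \<in> {0..1} - N \<Longrightarrow> u t \<in> Ku"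
    using admissible_input_compact[OF u] by blast
  define U where "U t = integral {0..t} (\<lambda>s. norm (h (u s)) powr p)" for t
  have inp: "(\<lambda>s. norm (h (u s)) powr p) integrable_on {0..t}" if "0 \<le> t" for t
    using input_power_integrable[OF u that] by (rule set_lebesgue_integral_eq_integral(1))
  have U_mono: "U t \<le> U 1" if "t \<in> {0..1}" for t
    unfolding U_def using that by (intro integral_subset_le inp) auto
  have "0 \<le> U 1" unfolding U_def by (intro integral_nonneg inp) auto
  \<comment> \<open>The first two terms are the a priori bound on the storage over the unit
    interval, \<open>V 0\<close> puts the right boundary value into \<open>\<Phi>\<close>, and 1
    makes the level positive.\<close>
  define \<rho>0 where "\<rho>0 = storage n \<xi> + \<Gamma>1 * U 1 + V 0 + 1"
  have rho0: "0 < \<rho>0" "storage n \<xi> + \<Gamma>1 * U 1 \<le> \<rho>0" "V 0 \<le> \<rho>0"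
    using storage_nonneg[of n \<xi>, OF xi] V_nonneg[OF zero_D] Gamma1 \<open>0 \<le> U 1\<close>
    unfolding \<rho>0_def by (auto simp: add_nonneg_pos)
  define \<Phi> where "\<Phi> = {\<xi>\<in>D. V \<xi> \<le> \<rho>0}"
  have "bounded (f ` ((Ku \<union> \<Phi>) \<times> \<Phi> \<times> \<Phi>))"
    unfolding \<Phi>_def by (rule f_bounded[OF Ku rho0(1)])
  then obtain M where "M > 0" and M: "\<And>a b c. \<lbrakk>a \<in> Ku \<union> \<Phi>; b \<in> \<Phi>; c \<in> \<Phi>\<rbrakk> \<Longrightarrow> norm (f (a, b, c)) \<le> M"
    unfolding bounded_pos by (metis (no_types, lifting) SigmaI imageI)
  \<comment> \<open>The velocity bound \<open>M\<close> depends on \<open>\<rho>0\<close> only, so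
    it may enter the radius: in unit time a component moves by at most \<open>M\<close> from its
    initial value.\<close>
  define \<rho> where "\<rho> = \<rho>0 + (\<Sum>i=1..n. norm (\<xi> i)) + M"
  have "\<rho>0 \<le> \<rho>" "0 < \<rho>" using rho0 \<open>M > 0\<close> by (simp_all add: \<rho>_def sum_nonneg add_pos_nonneg)
  have xi_rho: "norm (\<xi> i) + M \<le> \<rho>" if "i \<in> {1..n}" for i
    using rho0(1) member_le_sum[OF that, of "\<lambda>i. norm (\<xi> i)"] by (simp add: \<rho>_def)
  define K where "K = {\<xi>\<in>D. V \<xi> \<le> \<rho> \<and> norm \<xi> \<le> \<rho>}"
  have "compact K" unfolding K_def by (rule sublevel_compact[OF \<open>0 < \<rho>\<close>])
  have "K \<subseteq> D" by (auto simp: K_def)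
  have "0 \<in> K" using zero_D rho0(3) \<open>\<rho>0 \<le> \<rho>\<close> \<open>0 < \<rho>\<close> by (simp add: K_def)
  then have "K \<noteq> {}" by blast
  obtain \<delta> where "0 < \<delta>" and cK': "compact {z. infdist z K \<le> \<delta>}" and K'D: "{z. infdist z K \<le> \<delta>} \<subseteq> D"
    using compact_infdist_neighborhood[OF \<open>compact K\<close> \<open>K \<noteq> {}\<close> open_D \<open>K \<subseteq> D\<close>] by blast
  \<comment> \<open>The margin around \<open>K\<close>: as long as all components are in
    \<open>K'\<close> and the input is in \<open>Ku\<close>, truncated and original right-hand sides
    coincide.\<close>
  define K' where "K' = {z. infdist z K \<le> \<delta>}"
  have "0 \<in> K'" using \<open>0 \<in> K\<close> \<open>0 < \<delta>\<close> by (simp add: K'_def)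
  define C where "C = (Ku \<union> K') \<times> K' \<times> K'"
  have "compact C"
    unfolding C_def using Ku cK' by (intro compact_Times compact_Un) (auto simp: K'_def)
  have "C \<subseteq> D \<times> D \<times> D"
    unfolding C_def using Ku Omega_D K'D by (auto simp: K'_def)
  have "C \<noteq> {}" unfolding C_def using \<open>0 \<in> K'\<close> by blast
  obtain F \<Lambda> B where F_lip: "\<Lambda>-lipschitz_on UNIV F" and "0 \<le> B" and F_le: "\<And>z. norm (F z) \<le> B"
    and F_eq: "\<And>z. z \<in> C \<Longrightarrow> F z = f z"
    using locally_lipschitz_truncation[OF f_lip _ \<open>compact C\<close> \<open>C \<subseteq> D \<times> D \<times> D\<close> \<open>C \<noteq> {}\<close>] open_D
    by (metis open_Times)
  have "0 \<le> \<Lambda>" using F_lip by (rule lipschitz_on_nonneg)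
  obtain x0 where x0_cont: "\<And>i. i \<in> {1..n} \<Longrightarrow> continuous_on {0..1} (\<lambda>t. x0 t i)"
    and x0_int: "\<And>i t. \<lbrakk>i \<in> {1..n}; t \<in> {0..1}\<rbrakk> \<Longrightarrow>
      ((\<lambda>s. string_rhs F n (u s) 0 (x0 s) i) has_integral x0 t i - \<xi> i) {0..t}"
  proof (rule caratheodory_picard[of "{1..n}" 1 "3 * \<Lambda>" B "\<lambda>t z. string_rhs F n (u t) 0 z" \<xi>])
    show "(\<lambda>t. string_rhs F n (u t) 0 (y t) i) integrable_on {0..1}"
      if "i \<in> {1..n}" "\<And>j. j \<in> {1..n} \<Longrightarrow> continuous_on {0..1} (\<lambda>t. y t j)" for y i
      by (rule string_rhs_integrable[OF lipschitz_on_continuous_on[OF F_lip] F_le that(1)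
            admissible_input_measurable[OF u] that(2)])
    show "norm (string_rhs F n (u t) 0 z i - string_rhs F n (u t) 0 z' i) \<le> 3 * \<Lambda> * e"
      if "i \<in> {1..n}" "\<And>j. j \<in> {1..n} \<Longrightarrow> norm (z j - z' j) \<le> e" for t z z' i e
      by (rule string_rhs_lipschitz[OF F_lip that])
  qed (use \<open>0 \<le> \<Lambda>\<close> \<open>0 \<le> B\<close> F_le in \<open>auto simp: string_rhs_def\<close>)
  have x0_0: "x0 0 i = \<xi> i" if "i \<in> {1..n}" for i
  proof -
    have "((\<lambda>s. string_rhs F n (u s) 0 (x0 s) i) has_integral x0 0 i - \<xi> i) {0}"
      using x0_int[OF that, of 0] by simp
    then have "x0 0 i - \<xi> i = 0"
      by (rule has_integral_unique[OF _ has_integral_refl(2)])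
    then show ?thesis by simp
  qed
  have x0_between: "((\<lambda>s. string_rhs F n (u s) 0 (x0 s) i) has_integral x0 b i - x0 a i) {a..b}"
    if "i \<in> {1..n}" "0 \<le> a" "a \<le> b" "b \<le> 1" for i a b
  proof (rule has_integral_between[where T = 1 and x = "\<lambda>t. x0 t i", OF _ that(2-4)])
    show "((\<lambda>s. string_rhs F n (u s) 0 (x0 s) i) has_integral x0 t i - x0 0 i) {0..t}" if "t \<in> {0..1}" for t
      using x0_int[OF \<open>i \<in> {1..n}\<close> that] by (simp only: x0_0[OF \<open>i \<in> {1..n}\<close>])
  qed
  have x0_lip: "B-lipschitz_on {0..1} (\<lambda>t. x0 t i)" if "i \<in> {1..n}" for i
  proof (rule bounded_integrand_lipschitz[OF x0_between[OF that]])
    show "norm (string_rhs F n (u t) 0 (x0 t) i) \<le> B" for t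
      unfolding string_rhs_def by (rule F_le)
  qed
  have rhs_eq: "string_rhs F n (u t) 0 (x0 t) i = string_rhs f n (u t) 0 (x0 t) i"
    if "i \<in> {1..n}" "t \<in> {0..1} - N" "\<And>j. j \<in> {1..n} \<Longrightarrow> x0 t j \<in> K'" for i t
    unfolding string_rhs_def
    by (intro F_eq, unfold C_def) (intro SigmaI with_boundary_triple_mem[OF N(2)[OF that(2)] \<open>0 \<in> K'\<close> that(3,1)])
  have "\<forall>i\<in>{1..n}. \<exists>N'. negligible N' \<and> (\<forall>t\<in>{0<..<1} - N'.
      ((\<lambda>s. x0 s i) has_vector_derivative string_rhs F n (u t) 0 (x0 t) i) (at t))"
  proof
    fix i assume "i \<in> {1..n}"
    then show "\<exists>N'. negligible N' \<and> (\<forall>t\<in>{0<..<1} - N'.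
      ((\<lambda>s. x0 s i) has_vector_derivative string_rhs F n (u t) 0 (x0 t) i) (at t))"
      by (rule indefinite_integral_has_vector_derivative_ae[OF x0_between]) auto
  qed
  from bchoice[OF this] obtain N' where N'_all: "\<forall>i\<in>{1..n}. negligible (N' i) \<and> (\<forall>t\<in>{0<..<1} - N' i.
      ((\<lambda>s. x0 s i) has_vector_derivative string_rhs F n (u t) 0 (x0 t) i) (at t))"
    by blast
  then have N': "\<And>i. i \<in> {1..n} \<Longrightarrow> negligible (N' i)"
    "\<And>i t. \<lbrakk>i \<in> {1..n}; t \<in> {0<..<1} - N' i\<rbrakk> \<Longrightarrow>
      ((\<lambda>s. x0 s i) has_vector_derivative string_rhs F n (u t) 0 (x0 t) i) (at t)"
    by simp_all
  \<comment> \<open>The two endpoints are added because the derivatives are known only in the open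
    interval.\<close>
  define N0 where "N0 = N \<union> (\<Union>i\<in>{1..n}. N' i) \<union> {0, 1}"
  have "negligible N0"
    unfolding N0_def using N(1) N'(1) by (intro negligible_Un negligible_Union) auto
  have storage_le: "storage n (x0 \<tau>) \<le> \<rho>0"
    if \<tau>: "\<tau> \<in> {0..1}" and near: "\<And>s j. \<lbrakk>s \<in> {0..\<tau>}; j \<in> {1..n}\<rbrakk> \<Longrightarrow> x0 s j \<in> K'" for \<tau>
  proof -
    have x0D: "x0 s i \<in> D" if "i \<in> {1..n}" "s \<in> {0..\<tau>}" for i s
      using near[OF that(2,1)] K'D by (auto simp: K'_def)
    have ac: "abs_continuous_on_interval 0 \<tau> (\<lambda>t. x0 t i)" if "i \<in> {1..n}" for i
      by (rule lipschitz_imp_abs_continuous[OF lipschitz_on_subset[OF x0_lip[OF that]]]) (use \<tau> in auto)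
    have "storage n (x0 \<tau>) + \<kappa> * (\<Sum>i=1..n. L ^ (i - 1) * integral {0..\<tau>} (\<lambda>s. norm (h (x0 s i)) powr p))
        \<le> storage n (x0 0) + \<Gamma>1 * integral {0..\<tau>} (\<lambda>s. norm (h (u s)) powr p)"
    proof (rule storage_dissipation[OF \<open>1 \<le> n\<close> _ u x0D ac \<open>negligible N0\<close>])
      fix i t assume i: "i \<in> {1..n}" and t: "t \<in> {0..\<tau>} - N0"
      have "((\<lambda>s. x0 s i) has_vector_derivative string_rhs F n (u t) 0 (x0 t) i) (at t)"
        using i t \<tau> by (intro N'(2)) (auto simp: N0_def)
      moreover have "string_rhs F n (u t) 0 (x0 t) i = string_rhs f n (u t) 0 (x0 t) i"
        using i t \<tau> near by (intro rhs_eq) (auto simp: N0_def)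
      ultimately show "((\<lambda>s. x0 s i) has_vector_derivative string_rhs f n (u t) 0 (x0 t) i) (at t within {0..\<tau>})"
        by (simp add: has_vector_derivative_at_within)
    qed (use \<tau> in auto)
    moreover have "0 \<le> (\<Sum>i=1..n. L ^ (i - 1) * integral {0..\<tau>} (\<lambda>s. norm (h (x0 s i)) powr p))"
    proof (intro sum_nonneg mult_nonneg_nonneg)
      fix i assume i: "i \<in> {1..n}"
      have "(\<lambda>s. norm (h (x0 s i)) powr p) absolutely_integrable_on {0..\<tau>}"
        using x0D i by (intro output_power_integrable abs_continuous_imp_continuous_on ac) auto
      then show "0 \<le> integral {0..\<tau>} (\<lambda>s. norm (h (x0 s i)) powr p)"
        by (intro integral_nonneg set_lebesgue_integral_eq_integral(1)) auto
    qed (use L_ge in auto)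
    moreover have "\<Gamma>1 * U \<tau> \<le> \<Gamma>1 * U 1" using Gamma1 U_mono[OF \<tau>] by (rule mult_left_mono[rotated])
    moreover have "storage n (x0 0) = storage n \<xi>" using x0_0 by (simp add: storage_def)
    ultimately show ?thesis
      using rho0(2) kappa_pos mult_nonneg_nonneg[of \<kappa> "\<Sum>i=1..n. L ^ (i - 1) * integral {0..\<tau>} (\<lambda>s. norm (h (x0 s i)) powr p)"]
      unfolding U_def by linarith
  qed
  have inK: "x0 t i \<in> K" if "t \<in> {0..1}" "i \<in> {1..n}" for t i
  proof (rule first_exit_continuation[of "{1..n}" 1 x0 K \<delta>, OF _ x0_cont compact_imp_closed[OF \<open>compact K\<close>] \<open>K \<noteq> {}\<close> \<open>0 < \<delta>\<close> _ _ that])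
    show "x0 0 i \<in> K" if "i \<in> {1..n}" for i
    proof -
      have "V (\<xi> i) \<le> storage n \<xi>" using V_le_storage[of n \<xi>, OF xi that] by simp
      then have "V (\<xi> i) \<le> \<rho>"
        using rho0(2) \<open>\<rho>0 \<le> \<rho>\<close> mult_nonneg_nonneg[OF Gamma1 \<open>0 \<le> U 1\<close>] by linarith
      then show ?thesis
        using x0_0[OF that] xi[OF that] xi_rho[OF that] \<open>0 < M\<close> by (simp add: K_def)
    qed
    fix \<tau> i assume \<tau>: "\<tau> \<in> {0..1}" and "\<And>s j. s \<in> {0..\<tau>} \<Longrightarrow> j \<in> {1..n} \<Longrightarrow> infdist (x0 s j) K \<le> \<delta>" and i: "i \<in> {1..n}"
    then have near: "x0 s j \<in> K'" if "s \<in> {0..\<tau>}" "j \<in> {1..n}" for s j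
      using that by (simp add: K'_def)
    \<comment> \<open>The storage bound is applied at every earlier time \<open>s\<close>, so that
      the velocity bound \<open>M\<close> is available on all of \<open>{0..\<tau>}\<close>.\<close>
    have x0\<Phi>: "x0 s j \<in> \<Phi>" if s: "s \<in> {0..\<tau>}" and j: "j \<in> {1..n}" for s j
    proof -
      have D: "x0 s j \<in> D" if "j \<in> {1..n}" for j using near[OF s that] K'D by (auto simp: K'_def)
      have "V (x0 s j) \<le> storage n (x0 s)" by (rule V_le_storage[OF D j])
      also have "\<dots> \<le> \<rho>0" using s \<tau> near by (intro storage_le) auto
      finally show ?thesis using D[OF j] by (simp add: \<Phi>_def)
    qed
    have "0 \<in> \<Phi>" using zero_D rho0(3) by (simp add: \<Phi>_def)
    \<comment> \<open>The integral estimate needs a bound at every point, but on \<open>N\<close>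
      the input may lie outside \<open>Ku\<close>, where \<open>M\<close> says nothing; the
      integrand is therefore changed to 0 on this null set.\<close>
    define G where "G t = (if t \<in> N then 0 else string_rhs F n (u t) 0 (x0 t) i)" for t
    have "(G has_integral x0 \<tau> i - \<xi> i) {0..\<tau>}"
      using x0_int[OF i \<tau>] by (rule has_integral_spike[OF N(1), rotated]) (simp add: G_def)
    moreover have "norm (G t) \<le> M" if t: "t \<in> {0..\<tau>}" for t
    proof (cases "t \<in> N")
      case False
      have "string_rhs F n (u t) 0 (x0 t) i = string_rhs f n (u t) 0 (x0 t) i"
        using i t \<tau> near False by (intro rhs_eq) auto
      moreover have "norm (string_rhs f n (u t) 0 (x0 t) i) \<le> M"
      proof -
        have "u t \<in> Ku" using t \<tau> False by (intro N(2)) auto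
        then show ?thesis
          unfolding string_rhs_def
          by (intro M with_boundary_triple_mem[OF _ \<open>0 \<in> \<Phi>\<close> x0\<Phi>[OF t] i])
      qed
      ultimately show ?thesis using False by (simp add: G_def)
    qed (use \<open>M > 0\<close> in \<open>simp add: G_def\<close>)
    ultimately have "norm (x0 \<tau> i - \<xi> i) \<le> M * measure lborel {0..\<tau>}"
      using \<open>M > 0\<close> by (intro has_integral_bound_real[OF _ finite.emptyI]) auto
    also have "\<dots> \<le> M" using \<tau> \<open>M > 0\<close> by (simp add: mult_left_le)
    finally have "norm (x0 \<tau> i) \<le> \<rho>"
      using xi_rho[OF i] norm_triangle_sub[of "x0 \<tau> i" "\<xi> i"] by linarith
    moreover have "x0 \<tau> i \<in> \<Phi>" using x0\<Phi>[of \<tau> i] \<tau> i by simp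
    ultimately show "x0 \<tau> i \<in> K" using \<open>\<rho>0 \<le> \<rho>\<close> by (simp add: K_def \<Phi>_def)
  qed simp
  have inK': "x0 t i \<in> K'" if "t \<in> {0..1}" "i \<in> {1..n}" for t i
    using inK[OF that] \<open>0 < \<delta>\<close> by (simp add: K'_def)
  \<comment> \<open>Elements of \<open>states D n\<close> are undefined outside
    \<open>{1..n}\<close>; the restriction does not affect the right-hand side, which reads only
    these indices and the boundary values.\<close>
  define x where "x t = restrict (x0 t) {1..n}" for t
  have xx0: "x t i = x0 t i" if "i \<in> {1..n}" for t i using that by (simp add: x_def)
  show thesis
  proof (rule that)
    show "x 0 = \<xi>"
      using \<xi> x0_0 by (auto simp: x_def states_def PiE_def extensional_def fun_eq_iff)
    show "x t \<in> states D n" if "t \<in> {0..1}" for t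
      using inK[OF that] \<open>K \<subseteq> D\<close> by (auto simp: x_def states_def)
    show "B-lipschitz_on {0..1} (\<lambda>t. x t i)" if "i \<in> {1..n}" for i
      using x0_lip[OF that] by (simp add: xx0[OF that])
    fix i t assume i: "i \<in> {1..n}" and t: "t \<in> {0..1::real}"
    have "((\<lambda>s. string_rhs f n (u s) 0 (x s) i) has_integral x0 t i - \<xi> i) {0..t}"
    proof (rule has_integral_spike[OF N(1) _ x0_int[OF i t]])
      fix s assume "s \<in> {0..t} - N"
      then have "string_rhs F n (u s) 0 (x0 s) i = string_rhs f n (u s) 0 (x0 s) i"
        using t inK' by (intro rhs_eq i) auto
      moreover have "string_rhs f n (u s) 0 (x s) i = string_rhs f n (u s) 0 (x0 s) i"
        using i xx0 by (rule string_rhs_cong[rotated])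
      ultimately show "string_rhs f n (u s) 0 (x s) i = string_rhs F n (u s) 0 (x0 s) i" by simp
    qed
    then show "((\<lambda>s. string_rhs f n (u s) 0 (x s) i) has_integral x t i - \<xi> i) {0..t}"
      by (simp add: xx0[OF i])
  qed
qed

end

section \<open>Concatenation of unit intervals\<close>

lemma admissible_inputs_shift:
  assumes u: "u \<in> admissible_inputs A" and "0 \<le> k"
  shows "(\<lambda>t. u (k + t)) \<in> admissible_inputs A"
proof -
  have K: "\<exists>K. compact K \<and> K \<subseteq> A \<and> (AE t in lebesgue_on {0..T}. u (k + t) \<in> K)" for T
  proof -
    obtain K N where K: "compact K" "K \<subseteq> A" and N: "negligible N" "\<And>t. t \<in> {0..k+T} - N \<Longrightarrow> u t \<in> K"
      using admissible_input_compact[OF u] by blast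
    have "AE t in lebesgue_on {0..T}. u (k + t) \<in> K"
    proof (subst AE_lebesgue_on_negligible)
      have "u (k + t) \<in> K" if "t \<in> {0..T} - (+) (- k) ` N" for t
      proof (rule N(2))
        have "k + t \<notin> N" using that by (force simp: image_iff)
        then show "k + t \<in> {0..k+T} - N" using that \<open>0 \<le> k\<close> by auto
      qed
      then show "\<exists>N. negligible N \<and> (\<forall>t\<in>{0..T} - N. u (k + t) \<in> K)"
        using negligible_translation[OF N(1), of "- k"] by blast
    qed simp
    with K show ?thesis by blast
  qed
  have B: "\<exists>B. AE t in lebesgue_on {0..T}. norm (u (k + t)) \<le> B" for T
  proof -
    obtain K where K: "compact K" "AE t in lebesgue_on {0..T}. u (k + t) \<in> K" using K by blast
    obtain B where "\<forall>x\<in>K. norm x \<le> B" using compact_imp_bounded[OF K(1)] bounded_iff by blast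
    then show ?thesis using K(2) by (intro exI[of _ B]) (auto elim: eventually_mono)
  qed
  \<comment> \<open>Extended by zero, the input is Lebesgue measurable on the whole line and can be
    composed with the translation, which is measurable from \<open>lebesgue\<close> to
    \<open>lebesgue\<close>.\<close>
  have "(\<lambda>t. if t \<in> {0..} then u t else 0) \<in> borel_measurable lebesgue"
    using admissible_inputsD(1)[OF u] by (subst borel_measurable_if) auto
  moreover have "(\<lambda>t. k + t) \<in> lebesgue \<rightarrow>\<^sub>M lebesgue"
    using lebesgue_affine_measurable[of "\<lambda>_. 1 :: real" k] by simp
  ultimately have "(\<lambda>t. if k + t \<in> {0..} then u (k + t) else 0) \<in> borel_measurable lebesgue"
    by (rule measurable_compose[rotated])
  then have "(\<lambda>t. if k + t \<in> {0..} then u (k + t) else 0) \<in> borel_measurable (lebesgue_on {0..})"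
    by (rule measurable_restrict_space1)
  then have "(\<lambda>t. u (k + t)) \<in> borel_measurable (lebesgue_on {0..})"
    using \<open>0 \<le> k\<close> by (subst measurable_cong[where g = "\<lambda>t. if k + t \<in> {0..} then u (k + t) else 0"]) auto
  then show ?thesis
    using K B admissible_inputsD(2)[OF u] \<open>0 \<le> k\<close> by (simp add: admissible_inputs_def)
qed

text \<open>Lipschitz continuity gives absolute continuity, and differentiating the integral
  equation on each interval from 0 to \<open>m\<close> gives the differential equation off a null
  set; countably many such null sets cover the half-line.\<close>

lemma is_solutionI:
  assumes x0: "x 0 = \<xi>" and xD: "\<And>t. 0 \<le> t \<Longrightarrow> x t \<in> states D n"
    and int: "\<And>i t. \<lbrakk>i \<in> {1..n}; 0 \<le> t\<rbrakk> \<Longrightarrow>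
      ((\<lambda>s. string_rhs f n (u s) (w s) (x s) i) has_integral x t i - x 0 i) {0..t}"
    and lip: "\<And>i T. \<lbrakk>i \<in> {1..n}; 0 < T\<rbrakk> \<Longrightarrow> \<exists>B. B-lipschitz_on {0..T} (\<lambda>t. x t i)"
  shows "is_solution D f n \<xi> u w x"
  unfolding is_solution_def
proof (intro conjI ballI allI impI x0 xD)
  fix i T assume "i \<in> {1..n}" "0 < (T::real)"
  then show "abs_continuous_on_interval 0 T (\<lambda>t. x t i)"
    using lip lipschitz_imp_abs_continuous by blast
next
  fix i assume i: "i \<in> {1..n}"
  let ?G = "\<lambda>s. string_rhs f n (u s) (w s) (x s) i"
  have "\<exists>N. negligible N \<and> (\<forall>t\<in>{0<..<real m} - N. ((\<lambda>s. x s i) has_vector_derivative ?G t) (at t))" for m :: nat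
  proof -
    have "(?G has_integral x b i - x a i) {a..b}" if "0 \<le> a" "a \<le> b" "b \<le> real m" for a b
      by (rule has_integral_between[where T = "real m" and x = "\<lambda>t. x t i", OF int[OF i] that]) simp
    then show ?thesis
      by (rule indefinite_integral_has_vector_derivative_ae) auto
  qed
  then have "\<forall>m::nat. \<exists>N. negligible N \<and> (\<forall>t\<in>{0<..<real m} - N. ((\<lambda>s. x s i) has_vector_derivative ?G t) (at t))"
    by blast
  from choice[OF this] obtain N where N: "\<And>m. negligible (N m)"
    "\<And>m t. t \<in> {0<..<real m} - N m \<Longrightarrow> ((\<lambda>s. x s i) has_vector_derivative ?G t) (at t)"
    by blast
  have "negligible ({0} \<union> (\<Union>m. N m))"
    using N(1) by (intro negligible_Un negligible_countable_Union) auto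
  moreover have "((\<lambda>s. x s i) has_vector_derivative ?G t) (at t)" if "t \<in> {0..} - ({0} \<union> (\<Union>m. N m))" for t
  proof -
    obtain m :: nat where "t < real m" using reals_Archimedean2 by blast
    then show ?thesis using that by (intro N(2)[of t m]) auto
  qed
  ultimately have "\<exists>N. negligible N \<and> (\<forall>t\<in>{0..} - N. ((\<lambda>s. x s i) has_vector_derivative ?G t) (at t))"
    by (intro exI[of _ "{0} \<union> (\<Union>m. N m)"] conjI ballI)
  then show "AE t in lebesgue_on {0..}. ((\<lambda>s. x s i) has_vector_derivative ?G t) (at t)"
    by (simp add: AE_lebesgue_on_negligible)
qed

context proper_lyapunov_string
begin

lemma forward_complete_sublevel:
  assumes n: "1 \<le> n"
  shows "forward_complete D \<Omega> {0} f n"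
  unfolding forward_complete_def
proof (intro ballI)
  fix \<xi> u and w :: "real \<Rightarrow> real ^ 'k"
  assume \<xi>: "\<xi> \<in> states D n" and u: "u \<in> admissible_inputs \<Omega>" and w: "w \<in> admissible_inputs {0}"
  \<comment> \<open>Packaged as one predicate so that a solution \<open>S\<close> and a Lipschitz
    constant \<open>B\<close> can be chosen as functions of the initial state and the input.\<close>
  define sol where "sol \<xi> v x B \<longleftrightarrow> x 0 = \<xi> \<and> (\<forall>t\<in>{0..1}. x t \<in> states D n) \<and>
      (\<forall>i\<in>{1..n}. \<forall>t\<in>{0..1}. ((\<lambda>s. string_rhs f n (v s) 0 (x s) i) has_integral x t i - \<xi> i) {0..t}) \<and>
      (\<forall>i\<in>{1..n}. B-lipschitz_on {0..1} (\<lambda>t. x t i))" for \<xi> and v :: "real \<Rightarrow> real ^ 'k" and x B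
  have "\<exists>x B. sol \<xi> v x B" if "\<xi> \<in> states D n" "v \<in> admissible_inputs \<Omega>" for \<xi> v
  proof (rule unit_interval_solution[OF n that])
    fix x B
    assume "x 0 = \<xi>" "\<And>t. t \<in> {0..1} \<Longrightarrow> x t \<in> states D n"
      "\<And>i t. \<lbrakk>i \<in> {1..n}; t \<in> {0..1}\<rbrakk> \<Longrightarrow>
        ((\<lambda>s. string_rhs f n (v s) 0 (x s) i) has_integral x t i - \<xi> i) {0..t}"
      "\<And>i. i \<in> {1..n} \<Longrightarrow> B-lipschitz_on {0..1} (\<lambda>t. x t i)"
    then have "sol \<xi> v x B" unfolding sol_def by blast
    then show ?thesis by blast
  qed
  then obtain S B where SB_sol: "\<And>\<xi> v. \<lbrakk>\<xi> \<in> states D n; v \<in> admissible_inputs \<Omega>\<rbrakk> \<Longrightarrow> sol \<xi> v (S \<xi> v) (B \<xi> v)"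
    by metis
  note SB = SB_sol[unfolded sol_def]
  define v where "v k = (\<lambda>t. u (real k + t))" for k :: nat
  have v: "v k \<in> admissible_inputs \<Omega>" for k
    unfolding v_def using admissible_inputs_shift[OF u] by simp
  \<comment> \<open>The states at integer times: each is the endpoint of the unit solution started
    at the previous one with the correspondingly shifted input.\<close>
  define z where "z = rec_nat \<xi> (\<lambda>k \<zeta>. S \<zeta> (v k) 1)"
  have z0: "z 0 = \<xi>" and zSuc: "z (Suc k) = S (z k) (v k) 1" for k by (simp_all add: z_def)
  have z: "z k \<in> states D n" for k
  proof (induction k)
    case (Suc k)
    then show ?case using SB v[of k] by (simp add: zSuc)
  qed (simp add: z0 \<xi>)
  define x where "x t = S (z (nat \<lfloor>t\<rfloor>)) (v (nat \<lfloor>t\<rfloor>)) (t - real (nat \<lfloor>t\<rfloor>))" for t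
  \<comment> \<open>At \<open>t = real k + 1\<close> the floor already selects the next piece, which
    starts at the endpoint \<open>z (Suc k)\<close> of the current one; this agreement makes each
    formula valid on a closed unit interval.\<close>
  have piece: "x t = S (z k) (v k) (t - real k)" if "t \<in> {real k..real k + 1}" for k t
  proof (cases "t = real k + 1")
    case True
    then have "\<lfloor>t\<rfloor> = int (Suc k)" by (simp add: floor_eq_iff)
    then have "nat \<lfloor>t\<rfloor> = Suc k" by simp
    then show ?thesis using SB z[of "Suc k"] v[of "Suc k"] True by (simp add: x_def zSuc)
  next
    case False
    then have "\<lfloor>t\<rfloor> = int k" using that by (simp add: floor_eq_iff)
    then show ?thesis by (simp add: x_def)
  qed
  have at_nat: "x (real k) = z k" for k
    using piece[of "real k" k] SB z[of k] v[of k] by simp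
  let ?G = "\<lambda>i s. string_rhs f n (u s) (w s) (x s) i"
  have step_int: "(?G i has_integral x t i - z k i) {real k..t}" if i: "i \<in> {1..n}" and t: "t \<in> {real k..real k + 1}" for i k t
  proof -
    have "((\<lambda>s. string_rhs f n (v k s) 0 (S (z k) (v k) s) i) has_integral S (z k) (v k) (t - real k) i - z k i) {0..t - real k}"
      using SB z[of k] v[of k] i t by simp
    then have "((?G i \<circ> (+) (real k)) has_integral x t i - z k i) {0..t - real k}"
    proof (rule has_integral_eq_rhs[OF has_integral_eq[rotated]])
      fix s assume s: "s \<in> {0..t - real k}"
      then have "x (real k + s) = S (z k) (v k) s" using piece[of "real k + s" k] t by simp
      moreover have "w (real k + s) = 0" using admissible_inputsD(2)[OF w, of "real k + s"] s by simp
      ultimately show "string_rhs f n (v k s) 0 (S (z k) (v k) s) i = (?G i \<circ> (+) (real k)) s"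
        by (simp add: v_def)
    qed (simp add: piece[OF t])
    then show ?thesis by (simp add: has_integral_shift_Icc_real)
  qed
  have int_nat: "(?G i has_integral z k i - \<xi> i) {0..real k}" if i: "i \<in> {1..n}" for i k
  proof (induction k)
    case (Suc k)
    have "(?G i has_integral z (Suc k) i - z k i) {real k..real (Suc k)}"
      using step_int[OF i, of "real (Suc k)" k] by (simp only: at_nat) (simp add: add.commute)
    with Suc have "(?G i has_integral (z k i - \<xi> i) + (z (Suc k) i - z k i)) {0..real (Suc k)}"
      by (intro has_integral_combine[of 0 "real k"]) auto
    then show ?case by simp
  qed (simp add: z0 has_integral_refl)
  have lip_nat: "\<exists>M. M-lipschitz_on {0..real k} (\<lambda>t. x t i)" if i: "i \<in> {1..n}" for i k
  proof (induction k)
    case 0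
    show ?case by (intro exI[of _ 0]) (simp add: lipschitz_on_def)
  next
    case (Suc k)
    then obtain M where M: "M-lipschitz_on {0..real k} (\<lambda>t. x t i)" by blast
    have B: "(B (z k) (v k))-lipschitz_on {0..1} (\<lambda>t. S (z k) (v k) t i)"
      using SB z[of k] v[of k] i by blast
    have "(B (z k) (v k))-lipschitz_on {real k..real (Suc k)} (\<lambda>t. x t i)"
    proof (rule lipschitz_onI)
      fix s t assume st: "s \<in> {real k..real (Suc k)}" "t \<in> {real k..real (Suc k)}"
      then have "dist (S (z k) (v k) (s - real k) i) (S (z k) (v k) (t - real k) i)
          \<le> B (z k) (v k) * dist (s - real k) (t - real k)"
        by (intro lipschitz_onD[OF B]) auto
      then show "dist (x s i) (x t i) \<le> B (z k) (v k) * dist s t"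
        using st by (simp add: piece[of s k] piece[of t k] dist_real_def add.commute)
    qed (rule lipschitz_on_nonneg[OF B])
    from lipschitz_on_concat_max[OF M this refl] show ?case by auto
  qed
  have "is_solution D f n \<xi> u w x"
  proof (rule is_solutionI)
    show "x 0 = \<xi>" using at_nat[of 0] by (simp add: z0)
    fix t :: real assume t: "0 \<le> t"
    define k where "k = nat \<lfloor>t\<rfloor>"
    have k: "t \<in> {real k..real k + 1}" using t unfolding k_def by auto
    show "x t \<in> states D n"
      using SB z[of k] v[of k] k by (simp add: piece[OF k])
    fix i assume i: "i \<in> {1..n}"
    have "(?G i has_integral (z k i - \<xi> i) + (x t i - z k i)) {0..t}"
      using k by (intro has_integral_combine[OF _ _ int_nat[OF i, of k] step_int[OF i k]]) auto
    then show "(?G i has_integral x t i - x 0 i) {0..t}"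
      using at_nat[of 0] by (simp add: z0)
  next
    fix i T assume i: "i \<in> {1..n}" and "0 < (T::real)"
    obtain k :: nat where "T < real k" using reals_Archimedean2 by blast
    then have "{0..T} \<subseteq> {0..real k}" by auto
    then show "\<exists>B. B-lipschitz_on {0..T} (\<lambda>t. x t i)"
      using lip_nat[OF i, of k] lipschitz_on_subset by blast
  qed
  then show "\<exists>x. is_solution D f n \<xi> u w x" by blast
qed

end

theorem theorem5:
  fixes D \<Omega> :: "(real ^ 'k) set"
    and f :: "(real ^ 'k) \<times> (real ^ 'k) \<times> (real ^ 'k) \<Rightarrow> real ^ 'k"
    and h :: "real ^ 'k \<Rightarrow> real ^ 'm"
    and V :: "real ^ 'k \<Rightarrow> real"
    and g r :: "(real ^ 'k) \<times> (real ^ 'k) \<Rightarrow> real"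
    and p \<sigma> \<omega> \<Gamma>1 c L :: real
  assumes "open D" and "0 \<in> D" and "\<Omega> \<subseteq> D" and "0 \<in> \<Omega>"
    and "continuous_on D h" and "h 0 = 0"
    and "locally_lipschitz_on (D \<times> D \<times> D) f"
    and "1 \<le> p"
    and "C1_on D V" and "\<forall>x\<in>D. 0 \<le> V x"
    and "continuous_on (D \<times> D) g" and "continuous_on (D \<times> D) r"
    and "0 \<le> \<sigma>" and "0 \<le> \<omega>" and "0 \<le> \<Gamma>1" and "0 < c" and "1 \<le> L"
    and "\<forall>x\<in>D. \<forall>u\<in>D. \<forall>w\<in>D.
           grad V x \<bullet> f (u, x, w) \<le> - c * norm (h x) powr p + g (u, x) + r (x, w)"
    and "\<forall>x\<in>D. \<forall>u\<in>\<Omega>. g (u, x) \<le> \<Gamma>1 * norm (h u) powr p + c * \<omega> * norm (h x) powr p"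
    and "\<forall>x\<in>D. \<forall>w\<in>D.
           r (x, w) + L * g (x, w) \<le> c * \<sigma> * norm (h x) powr p + c * \<omega> * L * norm (h w) powr p"
    and "\<forall>x\<in>D. r (x, 0) \<le> c * \<sigma> * norm (h x) powr p"
    and "\<sigma> + \<omega> < 1"
  shows
    "((\<forall>n\<ge>1. forward_complete D \<Omega> {0} f n) \<longrightarrow>
        Lp_string_stable D \<Omega> {0} f h p \<and>
        (\<forall>n\<ge>1. string_estimate D \<Omega> {0} f h p
           (\<lambda>s. (\<Gamma>1 / (c * (1 - \<sigma> - \<omega>))) powr (1 / p) * s)
           (\<lambda>s. 0)
           (\<lambda>\<xi>. (1 / (c * (1 - \<sigma> - \<omega>)) * (\<Sum>i=1..n. L ^ (i - 1) * V (\<xi> i))) powr (1 / p)) n))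
     \<and>
     ((\<forall>\<rho>>0. compact {\<xi>\<in>D. V \<xi> \<le> \<rho> \<and> norm \<xi> \<le> \<rho>}) \<and>
      (\<forall>K \<rho>. compact K \<and> K \<subseteq> \<Omega> \<and> 0 < \<rho> \<longrightarrow>
         (let \<Phi> = {\<xi>\<in>D. V \<xi> \<le> \<rho>} in
            bounded (f ` (\<Phi> \<times> \<Phi> \<times> \<Phi>)) \<and>
            bounded (f ` (K \<times> \<Phi> \<times> \<Phi>)) \<and>
            bounded (f ` (\<Phi> \<times> \<Phi> \<times> {0})))) \<longrightarrow>
        Lp_string_stable D \<Omega> {0} f h p \<and>
        (\<forall>n\<ge>1. string_estimate D \<Omega> {0} f h p
           (\<lambda>s. (\<Gamma>1 / (c * (1 - \<sigma> - \<omega>))) powr (1 / p) * s)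
           (\<lambda>s. 0)
           (\<lambda>\<xi>. (1 / (c * (1 - \<sigma> - \<omega>)) * (\<Sum>i=1..n. L ^ (i - 1) * V (\<xi> i))) powr (1 / p)) n))"
proof -
  interpret lyapunov_string D \<Omega> f h V g r p \<sigma> \<omega> \<Gamma>1 c L
    using assms by unfold_locales auto
  let ?estimate = "\<forall>n\<ge>1. string_estimate D \<Omega> {0} f h p
      (\<lambda>s. (\<Gamma>1 / (c * (1 - \<sigma> - \<omega>))) powr (1 / p) * s) (\<lambda>s. 0)
      (\<lambda>\<xi>. (1 / (c * (1 - \<sigma> - \<omega>)) * (\<Sum>i=1..n. L ^ (i - 1) * V (\<xi> i))) powr (1 / p)) n"
  have estimate: ?estimate using string_estimate_storage by blast
  show ?thesis
  proof (intro conjI impI estimate)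
    assume "\<forall>n\<ge>1. forward_complete D \<Omega> {0} f n"
    then show "Lp_string_stable D \<Omega> {0} f h p" by (intro Lp_string_stableI) blast
  next
    assume proper: "(\<forall>\<rho>>0. compact {\<xi>\<in>D. V \<xi> \<le> \<rho> \<and> norm \<xi> \<le> \<rho>}) \<and>
      (\<forall>K \<rho>. compact K \<and> K \<subseteq> \<Omega> \<and> 0 < \<rho> \<longrightarrow>
         (let \<Phi> = {\<xi>\<in>D. V \<xi> \<le> \<rho>} in
            bounded (f ` (\<Phi> \<times> \<Phi> \<times> \<Phi>)) \<and>
            bounded (f ` (K \<times> \<Phi> \<times> \<Phi>)) \<and>
            bounded (f ` (\<Phi> \<times> \<Phi> \<times> {0}))))"
    interpret proper_lyapunov_string D \<Omega> f h V g r p \<sigma> \<omega> \<Gamma>1 c L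
    proof unfold_locales
      show "compact {\<xi>\<in>D. V \<xi> \<le> \<rho> \<and> norm \<xi> \<le> \<rho>}" if "0 < \<rho>" for \<rho>
        using proper that by blast
      show "bounded (f ` ((K \<union> {\<xi>\<in>D. V \<xi> \<le> \<rho>}) \<times> {\<xi>\<in>D. V \<xi> \<le> \<rho>} \<times> {\<xi>\<in>D. V \<xi> \<le> \<rho>}))"
        if "compact K" "K \<subseteq> \<Omega>" "0 < \<rho>" for K \<rho>
        using proper that by (simp add: Let_def Sigma_Un_distrib1 image_Un)
    qed
    show "Lp_string_stable D \<Omega> {0} f h p"
      using forward_complete_sublevel by (intro Lp_string_stableI)
  qed
qed

end
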